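(* Let $\Gamma$ be a connected sesqui-regular graph with parameters $(n,k,c)$, where $k-2\geq c\geq 9$, and smallest eigenvalue $\lambda_{\min}(\Gamma)\in[-3,-2)$. If $\Gamma$ is $1$-integrable, then $c=9$ and $\Gamma$ is the block graph of a Steiner triple system.
   Context: All graphs are finite, undirected and simple; eigenvalues of a graph are the eigenvalues of its adjacency matrix, and $\lambda_{\min}(\Gamma)$ is the smallest one. A regular graph with $n$ vertices and valency $k$ is sesqui-regular with parameters $(n,k,c)$ if any two vertices at distance $2$ have exactly $c$ common neighbors. For a positive integer $s$, a graph $\Gamma$ is $s$-integrable if to each vertex $x$ of $\Gamma$ one can assign an integral vector $\mathbf{x}$ (all in a common $\mathbb{Z}^m$) such that, with the standard inner product, $(\mathbf{x},\mathbf{y})=s\lceil-\lambda_{\min}(\Gamma)\rceil$ if $x=y$, $(\mathbf{x},\mathbf{y})=s$ if $x$ is adjacent to $y$, and $(\mathbf{x},\mathbf{y})=0$ otherwise. A Steiner triple system $STS(v)$ is a pair $(\mathcal{P},\mathcal{B})$, where $\mathcal{P}$ is a $v$-element set (points) and $\mathcal{B}$ is a family of $3$-element subsets of $\mathcal{P}$ (blocks) such that each $2$-element subset of $\mathcal{P}$ is contained in exactly one block. Its block graph has vertex set $\mathcal{B}$, two blocks being adjacent whenever they intersect in exactly one point. *)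

theory Defs
  imports
    "Graph_Theory.Pair_Digraph"
    "Graph_Theory.Digraph_Component"
    "Graph_Theory.Digraph_Isomorphism"
    "Graph_Theory.Shortest_Path"
    "Jordan_Normal_Form.Char_Poly"
begin

text \<open>
  A finite undirected simple graph is a \<^locale>\<open>pair_graph\<close>: finitely many vertices, and an
  irreflexive symmetric set of ordered pairs as arcs.
\<close>

definition distance :: "'a pair_pre_digraph \<Rightarrow> 'a \<Rightarrow> 'a \<Rightarrow> ereal" where
  "distance G x y = wf_digraph.\<mu> (with_proj G) (\<lambda>_. 1) x y"

definition sesqui_regular :: "'a pair_pre_digraph \<Rightarrow> nat \<Rightarrow> nat \<Rightarrow> nat \<Rightarrow> bool" where
  "sesqui_regular G n k c \<longleftrightarrow>
     card (pverts G) = n \<and>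
     (\<forall>x\<in>pverts G. out_degree (with_proj G) x = k) \<and>
     (\<forall>x\<in>pverts G. \<forall>y\<in>pverts G. distance G x y = 2 \<longrightarrow>
        card {z \<in> pverts G. (x, z) \<in> parcs G \<and> (y, z) \<in> parcs G} = c)"

text \<open>
  The adjacency matrix depends on the order \<open>xs\<close> in which the vertices are listed; its
  eigenvalues do not, since reordering conjugates the matrix by a permutation matrix.
  It is real symmetric, so nothing is lost by considering real eigenvalues only.
\<close>

definition adjacency_mat :: "'a pair_pre_digraph \<Rightarrow> 'a list \<Rightarrow> real mat" where
  "adjacency_mat G xs =
     mat (length xs) (length xs) (\<lambda>(i, j). if (xs ! i, xs ! j) \<in> parcs G then 1 else 0)"

definition graph_eigenvalues :: "'a pair_pre_digraph \<Rightarrow> real set" where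
  "graph_eigenvalues G =
     {\<theta>. \<exists>xs. distinct xs \<and> set xs = pverts G \<and> eigenvalue (adjacency_mat G xs) \<theta>}"

definition lambda_min :: "'a pair_pre_digraph \<Rightarrow> real" where
  "lambda_min G = Min (graph_eigenvalues G)"

definition integrable_graph :: "nat \<Rightarrow> 'a pair_pre_digraph \<Rightarrow> bool" where
  "integrable_graph s G \<longleftrightarrow>
     (\<exists>(m :: nat) (f :: 'a \<Rightarrow> int vec).
        (\<forall>x\<in>pverts G. f x \<in> carrier_vec m) \<and>
        (\<forall>x\<in>pverts G. \<forall>y\<in>pverts G.
           f x \<bullet> f y =
             (if x = y then int s * \<lceil>- lambda_min G\<rceil>
              else if (x, y) \<in> parcs G then int s
              else 0)))"

definition steiner_triple_system :: "nat \<Rightarrow> 'p set \<Rightarrow> 'p set set \<Rightarrow> bool" where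
  "steiner_triple_system v P B \<longleftrightarrow>
     finite P \<and> card P = v \<and>
     (\<forall>b\<in>B. b \<subseteq> P \<and> card b = 3) \<and>
     (\<forall>e. e \<subseteq> P \<and> card e = 2 \<longrightarrow> (\<exists>!b. b \<in> B \<and> e \<subseteq> b))"

definition block_graph :: "'p set set \<Rightarrow> 'p set pair_pre_digraph" where
  "block_graph B = \<lparr> pverts = B, parcs = {(b, b'). b \<in> B \<and> b' \<in> B \<and> card (b \<inter> b') = 1} \<rparr>"

text \<open>
  ``Is the block graph of a Steiner triple system'' means isomorphic to one. Taking the points
  to be natural numbers is no restriction, since a point set is finite.
\<close>

definition is_sts_block_graph :: "'a pair_pre_digraph \<Rightarrow> bool" where
  "is_sts_block_graph G \<longleftrightarrow>
     (\<exists>(v :: nat) (P :: nat set) B.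
        steiner_triple_system v P B \<and> digraph_iso (with_proj G) (with_proj (block_graph B)))"

end

theory Submission
  imports Defs "HOL-Library.Nat_Bijection"
begin

text \<open>
  Since \<open>lambda_min G\<close> lies in \<open>[- 3, - 2)\<close>, the vectors that represent the vertices have norm three,
  so each has exactly three nonzero entries, which are \<open>1\<close> or \<open>- 1\<close>. A vertex thus becomes a line, a set of
  three signed points. Two lines are adjacent if they share one point and contain no opposite points,
  or if they are twins: they share two points and their third points are opposite. They are
  nonadjacent if they are disjoint, or if they share one point and contain one opposite pair. In the
  block graph of a Steiner triple system no opposite points occur, and the task is to exclude them.

  The main tool is a count. A common neighbour of two disjoint lines joins a point of the first to a
  point of the second. There are nine pairs of points, and a pair is joined by at most two lines, by
  two only if they are twins; as \<open>c \<ge> 9\<close>, most pairs must be joined. In particular two disjoint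
  lines with twins are never at distance two (\<open>no_disjoint_twins\<close>), because the points that
  distinguish them from their twins are on no other lines.

  First, every line has a disjoint line at distance two (\<open>ex_disjoint_at_distance_two\<close>). Otherwise \<open>x\<close>
  and some \<open>y\<close> at distance two share a point \<open>p\<close>, nearly all of their common neighbours pass through \<open>p\<close>,
  and connectedness spreads this to all lines. Then a line has at most two nonneighbours, which gives
  \<open>k \<le> c + 1\<close>; this is where \<open>c + 2 \<le> k\<close> enters. Second, there are no twins (\<open>card_joining_le_1\<close>):
  if \<open>x\<close> has a twin and \<open>z\<close> is disjoint from \<open>x\<close> at distance two, one point of \<open>x\<close> is joined by twins to all
  points of \<open>z\<close>, and such a configuration violates regularity. Third, no opposite points remain
  (\<open>unopposed\<close>), as a point with an opposite would lie on at most two lines, too few for nine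
  common neighbours.

  Now two disjoint lines at distance two have exactly nine common neighbours, one for each pair of
  points, so \<open>c = 9\<close>; it follows that any two points are joined by exactly one line (\<open>ex1_line\<close>).
\<close>

section \<open>Lines of three signed points\<close>

lemma uminus_image_iff: "x \<in> uminus ` A \<longleftrightarrow> - x \<in> A" for x :: int
  by (metis add.inverse_inverse image_iff)

lemma distinct_triple: "card {a, b, d} = 3 \<Longrightarrow> a \<noteq> b \<and> a \<noteq> d \<and> b \<noteq> d"
  by (auto simp: card_insert_if split: if_splits)

text \<open>
  Points are nonzero integers, and \<open>- a\<close> is the point opposite to \<open>a\<close>: a vector whose nonzero
  entries are \<open>1\<close> or \<open>- 1\<close> is the set of the points \<open>i\<close> at which it is \<open>1\<close> and \<open>- i\<close> at which it is
  \<open>- 1\<close>. The inner product of two such vectors is the number of common points minus the number of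
  opposite pairs. A vector of norm three is a triple, here called a line; inner products zero and
  one between distinct vectors give the last axiom.
\<close>

locale signed_triples =
  fixes L :: "int set set"
  assumes finite_lines: "finite L"
    and card_line: "l \<in> L \<Longrightarrow> card l = 3"
    and no_opposite: "l \<in> L \<Longrightarrow> a \<in> l \<Longrightarrow> - a \<notin> l"
    and inner: "l \<in> L \<Longrightarrow> m \<in> L \<Longrightarrow> l \<noteq> m \<Longrightarrow>
      card (l \<inter> m) = card (l \<inter> uminus ` m) \<or> card (l \<inter> m) = Suc (card (l \<inter> uminus ` m))"
begin

definition adj :: "int set \<Rightarrow> int set \<Rightarrow> bool" where
  "adj l m \<longleftrightarrow> l \<in> L \<and> m \<in> L \<and> l \<noteq> m \<and> card (l \<inter> m) = Suc (card (l \<inter> uminus ` m))"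

definition nbrs :: "int set \<Rightarrow> int set set" where
  "nbrs l = {m. adj l m}"

definition through :: "int \<Rightarrow> int set set" where
  "through a = {l \<in> L. a \<in> l}"

definition joining :: "int \<Rightarrow> int \<Rightarrow> int set set" where
  "joining a b = {l \<in> L. a \<in> l \<and> b \<in> l}"

lemma finite_line: "l \<in> L \<Longrightarrow> finite l"
  using card_line by (metis card.infinite zero_neq_numeral)

lemma finite_through [simp]: "finite (through a)"
  and finite_joining [simp]: "finite (joining a b)"
  and finite_nbrs [simp]: "finite (nbrs l)"
  using finite_lines by (auto simp: through_def joining_def nbrs_def adj_def)

lemma line_cases:
  assumes "l \<in> L"
  obtains a b d where "l = {a, b, d}" "a \<noteq> b" "a \<noteq> d" "b \<noteq> d"
  using card_line[OF assms] by (auto simp: card_Suc_eq numeral_3_eq_3)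

lemma line_cases_point:
  assumes "l \<in> L" "a \<in> l"
  obtains b d where "l = {a, b, d}" "a \<noteq> b" "a \<noteq> d" "b \<noteq> d"
  using assms by (elim line_cases) (auto simp: insert_commute)

lemma line_cases_pair:
  assumes "l \<in> L" "a \<in> l" "b \<in> l" "a \<noteq> b"
  obtains d where "l = {a, b, d}" "a \<noteq> d" "b \<noteq> d"
  using assms(1,2) by (rule line_cases_point) (use assms in \<open>auto simp: insert_commute\<close>)

lemma opposite_imp_common:
  assumes "l \<in> L" "m \<in> L" "t \<in> l" "- t \<in> m"
  obtains a where "a \<in> l" "a \<in> m"
proof -
  have "t \<in> l \<inter> uminus ` m" using assms by (simp add: uminus_image_iff)
  then have "card (l \<inter> uminus ` m) > 0"
    using finite_line[OF assms(1)] by (auto simp: card_gt_0_iff)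
  moreover have "l \<noteq> m" using assms no_opposite by blast
  ultimately have "card (l \<inter> m) > 0" using inner[OF assms(1,2)] by linarith
  then show ?thesis using that by (auto simp: card_gt_0_iff)
qed

lemma card_common_opposite:
  assumes "l \<in> L" "m \<in> L"
  shows "card (l \<inter> m) + card (l \<inter> uminus ` m) \<le> 3"
proof -
  have "(l \<inter> m) \<inter> (l \<inter> uminus ` m) = {}" using no_opposite[OF assms(2)] by force
  then have "card (l \<inter> m) + card (l \<inter> uminus ` m) = card ((l \<inter> m) \<union> (l \<inter> uminus ` m))"
    by (intro card_Un_disjoint[symmetric]) (use finite_line[OF assms(1)] in auto)
  also have "\<dots> \<le> card l" using finite_line[OF assms(1)] by (intro card_mono) auto
  finally show ?thesis using card_line[OF assms(1)] by simp
qed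

text \<open>
  A second opposite pair would force two common points, which is too much for lines of three
  points.
\<close>

lemma opposite_unique:
  assumes "l \<in> L" "m \<in> L" "s \<in> l" "t \<in> l" "- s \<in> m" "- t \<in> m"
  shows "s = t"
proof (rule ccontr)
  assume "s \<noteq> t"
  have "{s, t} \<subseteq> l \<inter> uminus ` m" using assms by (simp add: uminus_image_iff)
  then have "card {s, t} \<le> card (l \<inter> uminus ` m)"
    using finite_line[OF assms(1)] by (intro card_mono) auto
  moreover have "l \<noteq> m" using assms no_opposite by blast
  ultimately show False
    using inner[OF assms(1,2)] card_common_opposite[OF assms(1,2)] \<open>s \<noteq> t\<close> by auto
qed

text \<open>
  Two common points must be balanced by an opposite pair, so the lines agree up to the sign of
  one point. Such lines are called twins in what follows. They have inner product one, hence are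
  adjacent, and have the same neighbours apart from each other.
\<close>

lemma two_common:
  assumes "l \<in> L" "m \<in> L" "l \<noteq> m" "a \<noteq> b" "a \<in> l" "b \<in> l" "a \<in> m" "b \<in> m"
  obtains t where "l = {a, b, t}" "m = {a, b, - t}" "t \<noteq> a" "t \<noteq> b" "- t \<noteq> a" "- t \<noteq> b"
proof -
  have "{a, b} \<subseteq> l \<inter> m" using assms by auto
  then have "card {a, b} \<le> card (l \<inter> m)"
    using finite_line[OF assms(1)] by (intro card_mono) auto
  then have "card (l \<inter> uminus ` m) > 0" using inner[OF assms(1-3)] assms(4) by auto
  then obtain t where t: "t \<in> l" "- t \<in> m"
    by (metis Int_iff card_gt_0_iff ex_in_conv uminus_image_iff)
  have "t \<noteq> a" "t \<noteq> b" "- t \<noteq> a" "- t \<noteq> b" 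
    using t assms(5-8) no_opposite[OF assms(1), of a] no_opposite[OF assms(1), of b]
      no_opposite[OF assms(2), of a] no_opposite[OF assms(2), of b] by auto
  moreover have "l = {a, b, t}" using t \<open>t \<noteq> a\<close> \<open>t \<noteq> b\<close>
    by (metis line_cases_pair[OF assms(1,5,6,4)] insertE singletonD)
  moreover have "m = {a, b, - t}" using t \<open>- t \<noteq> a\<close> \<open>- t \<noteq> b\<close>
    by (metis line_cases_pair[OF assms(2,7,8,4)] insertE singletonD)
  ultimately show ?thesis using that by blast
qed

lemma adj_sym: "adj l m \<Longrightarrow> adj m l"
proof -
  have "card (m \<inter> uminus ` l) = card (l \<inter> uminus ` m)"
    by (rule bij_betw_same_card[of uminus]) (auto simp: bij_betw_def inj_on_def image_iff, force+)
  then show "adj l m \<Longrightarrow> adj m l" by (auto simp: adj_def Int_commute)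
qed

lemma adj_lines: "adj l m \<Longrightarrow> l \<in> L" "adj l m \<Longrightarrow> m \<in> L" "adj l m \<Longrightarrow> l \<noteq> m"
  by (auto simp: adj_def)

lemma adj_common:
  assumes "adj l m" obtains a where "a \<in> l" "a \<in> m"
proof -
  have "l \<inter> m \<noteq> {}" using assms by (auto simp: adj_def)
  then show ?thesis using that by blast
qed

lemma adj_opposite:
  assumes "adj l m" "t \<in> l" "- t \<in> m"
  obtains a b where "a \<noteq> b" "l = {a, b, t}" "m = {a, b, - t}"
proof -
  have L: "l \<in> L" "m \<in> L" "l \<noteq> m" using assms adj_lines by auto
  have "t \<in> l \<inter> uminus ` m" using assms by (simp add: uminus_image_iff)
  then have "card (l \<inter> uminus ` m) > 0"
    using finite_line[OF L(1)] by (auto simp: card_gt_0_iff)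
  then have "card (l \<inter> m) \<ge> 2" using assms by (auto simp: adj_def)
  then obtain S where "S \<subseteq> l \<inter> m" "card S = 2" by (meson obtain_subset_with_card_n)
  then obtain a b where ab: "a \<noteq> b" "a \<in> l" "a \<in> m" "b \<in> l" "b \<in> m" by (auto simp: card_2_iff)
  then obtain s where "l = {a, b, s}" "m = {a, b, - s}" using two_common[OF L] by metis
  moreover have "s = t" using opposite_unique[OF L(1,2), of s t] assms calculation by auto
  ultimately show ?thesis using that ab by blast
qed

lemma adjI:
  assumes "l \<in> L" "m \<in> L" "l \<noteq> m" "a \<in> l" "a \<in> m" "\<And>t. t \<in> l \<Longrightarrow> - t \<notin> m"
  shows "adj l m"
proof -
  have "l \<inter> uminus ` m = {}" using assms(6) by force
  moreover have "card (l \<inter> m) > 0" using assms finite_line[OF assms(1)] by (auto simp: card_gt_0_iff)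
  ultimately show ?thesis using inner[OF assms(1-3)] assms(1-3) unfolding adj_def by (metis card.empty less_irrefl)
qed

lemma adjI2:
  assumes "l \<in> L" "m \<in> L" "l \<noteq> m" "a \<noteq> b" "a \<in> l" "b \<in> l" "a \<in> m" "b \<in> m"
  shows "adj l m"
proof -
  have "{a, b} \<subseteq> l \<inter> m" using assms by auto
  then have "card {a, b} \<le> card (l \<inter> m)"
    using finite_line[OF assms(1)] by (intro card_mono) auto
  then show ?thesis
    using inner[OF assms(1-3)] card_common_opposite[OF assms(1,2)] assms by (auto simp: adj_def)
qed

lemma disjoint_opposite:
  assumes "l \<in> L" "m \<in> L" "l \<inter> m = {}" "t \<in> l"
  shows "- t \<notin> m"
  using opposite_imp_common[OF assms(1,2,4)] assms(3) by blast

lemma disjoint_not_adj: "l \<inter> m = {} \<Longrightarrow> \<not> adj l m"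
  by (auto elim: adj_common)

text \<open>
  The point in which two twins differ lies on no further line: such a line has to share a point
  with the twin that contains the opposite of \<open>t\<close>, hence two points with the other twin, and then
  its third point belongs to a second opposite pair.
\<close>

lemma twin_third_unique:
  assumes "{a, b, t} \<in> L" "{a, b, - t} \<in> L" "w \<in> L" "t \<in> w"
  shows "w = {a, b, t}"
proof (rule ccontr)
  assume ne: "w \<noteq> {a, b, t}"
  obtain e where e: "e \<in> w" "e \<in> {a, b, - t}"
    using opposite_imp_common[OF assms(3,2,4)] by blast
  have "- t \<notin> w" using no_opposite assms by blast
  then have e2: "e = a \<or> e = b" using e by auto
  have "e \<noteq> t" using e2 assms no_opposite by (metis insertCI)
  then obtain s where s: "w = {e, t, s}" "{a, b, t} = {e, t, - s}" 
    using two_common[OF assms(3,1) ne, of e t] e e2 assms(4) by blast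
  have d: "a \<noteq> b" "a \<noteq> t" "b \<noteq> t"
    using distinct_triple card_line[OF assms(1)] by metis+
  have "- s \<in> {a, b}" using s d e2 by auto
  then have "s = t"
    using opposite_unique[OF assms(3,2), of s t] s assms(4) by auto
  moreover have "- s \<in> {a, b, t}" using s by auto
  ultimately show False using no_opposite[OF assms(1), of t] by auto
qed

lemma joining_cases:
  assumes "l \<in> joining a b" "a \<noteq> b"
  obtains t where "l = {a, b, t}" "joining a b \<subseteq> {{a, b, t}, {a, b, - t}}"
proof -
  have l: "l \<in> L" "a \<in> l" "b \<in> l" using assms by (auto simp: joining_def)
  then obtain t where t: "l = {a, b, t}" "a \<noteq> t" "b \<noteq> t" using line_cases_pair assms(2) by metis
  have "m = {a, b, t} \<or> m = {a, b, - t}" if "m \<in> joining a b" for m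
  proof (cases "l = m")
    case False
    have "m \<in> L" "a \<in> m" "b \<in> m" using that by (auto simp: joining_def)
    then obtain s where s: "l = {a, b, s}" "m = {a, b, - s}" "s \<noteq> a" "s \<noteq> b"
      using two_common[of l m a b] False l assms(2) by metis
    then have "s = t" using t by auto
    then show ?thesis using s by auto
  qed (use t in auto)
  then show ?thesis using that t by blast
qed

lemma card_joining: 
  assumes "a \<noteq> b" shows "card (joining a b) \<le> 2"
proof (cases "joining a b = {}")
  case False
  then obtain t where "joining a b \<subseteq> {{a, b, t}, {a, b, - t}}"
    using joining_cases assms by (metis all_not_in_conv)
  then have "card (joining a b) \<le> card {{a, b, t}, {a, b, - t}}" by (intro card_mono) auto
  also have "\<dots> \<le> 2" by (simp add: card_insert_if)
  finally show ?thesis .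
qed simp

text \<open>
  Two points are joined by at most two lines, and by two lines only if these are twins.
\<close>

lemma joining_twins:
  assumes "a \<noteq> b" "card (joining a b) \<ge> 2"
  obtains t where "{a, b, t} \<in> L" "{a, b, - t} \<in> L" "joining a b = {{a, b, t}, {a, b, - t}}"
proof -
  have "joining a b \<noteq> {}" using assms by auto
  then obtain t where t: "joining a b \<subseteq> {{a, b, t}, {a, b, - t}}"
    using joining_cases assms by (metis all_not_in_conv)
  moreover have "joining a b = {{a, b, t}, {a, b, - t}}"
    using t assms(2) by (intro card_seteq) (auto simp: card_insert_if)
  ultimately show ?thesis using that[of t] by (auto simp: joining_def)
qed

text \<open>
  A line through \<open>p\<close> shares one of the two points other than \<open>- p\<close> with the given line, and each
  of these two points is joined to \<open>p\<close> by at most two lines. A point on more than four lines has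
  therefore no opposite point.
\<close>

lemma card_through_opposite:
  assumes "l \<in> L" "- p \<in> l"
  shows "card (through p) \<le> 4"
proof -
  obtain a b where ab: "l = {- p, a, b}" "- p \<noteq> a" "- p \<noteq> b" "a \<noteq> b"
    using line_cases_point[OF assms] by metis
  have ne: "p \<noteq> a" "p \<noteq> b" using no_opposite[OF assms(1)] ab by force+
  have "through p \<subseteq> joining p a \<union> joining p b"
  proof
    fix m assume "m \<in> through p"
    then have m: "m \<in> L" "p \<in> m" by (auto simp: through_def)
    then obtain e where "e \<in> m" "e \<in> l" using opposite_imp_common[OF m(1) assms(1) m(2) assms(2)] by blast
    then show "m \<in> joining p a \<union> joining p b" using m ab no_opposite[OF m] by (auto simp: joining_def)
  qed
  then have "card (through p) \<le> card (joining p a \<union> joining p b)" by (intro card_mono) auto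
  also have "\<dots> \<le> card (joining p a) + card (joining p b)" by (rule card_Un_le)
  finally show ?thesis using card_joining[OF ne(1)] card_joining[OF ne(2)] by linarith
qed

lemma common_nbr_disjoint:
  assumes "l \<in> L" "m \<in> L" "l \<inter> m = {}" "M \<in> nbrs l \<inter> nbrs m"
  obtains i j where "i \<in> l" "j \<in> m" "M \<in> joining i j"
  using assms by (auto simp: nbrs_def joining_def) (metis adj_common adj_lines(2))

lemma card_through_meeting:
  assumes "p \<notin> m" "finite m"
  shows "card {l \<in> through p. l \<inter> m \<noteq> {}} \<le> 2 * card m"
proof -
  have "{l \<in> through p. l \<inter> m \<noteq> {}} = (\<Union>i\<in>m. joining p i)" by (auto simp: through_def joining_def)
  also have "card \<dots> \<le> (\<Sum>i\<in>m. card (joining p i))" by (rule card_UN_le[OF assms(2)])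
  also have "\<dots> \<le> (\<Sum>i\<in>m. 2)" using assms by (intro sum_mono card_joining) auto
  finally show ?thesis by simp
qed

text \<open>
  The second kind of nonadjacency: one common point, one opposite pair and nothing else.
\<close>

lemma nonadj_meeting:
  assumes "x \<in> L" "y \<in> L" "x \<noteq> y" "\<not> adj x y" "x \<inter> y \<noteq> {}"
  obtains p q t g where "x = {p, q, t}" "y = {p, - q, g}" "x \<inter> y = {p}"
    "distinct [p, q, t]" "distinct [p, - q, g]" "g \<notin> x" "- g \<notin> x"
proof -
  obtain p where p: "p \<in> x" "p \<in> y" using assms by blast
  obtain q where q: "q \<in> x" "- q \<in> y" using adjI[OF assms(1-3) p] assms(4) by blast
  have pq: "p \<noteq> q" "p \<noteq> - q" using p q no_opposite assms by force+
  obtain t where t: "x = {p, q, t}" "p \<noteq> t" "q \<noteq> t" using line_cases_pair[OF assms(1) p(1) q(1) pq(1)] by metis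
  obtain g where g: "y = {p, - q, g}" "p \<noteq> g" "- q \<noteq> g" using line_cases_pair[OF assms(2) p(2) q(2) pq(2)] by metis
  have "x \<inter> y = {p}"
    using adjI2[OF assms(1-3)] assms(4) p by blast
  moreover have "g \<notin> x"
  proof
    assume "g \<in> x"
    then have "g \<in> x \<inter> y" using g(1) by blast
    then show False using calculation g(2) by simp
  qed
  moreover have "- g \<notin> x" 
  proof
    assume "- g \<in> x"
    moreover have "- (- g) \<in> y" using g(1) by simp
    ultimately have "q = - g" using opposite_unique[OF assms(1,2) q(1)] q(2) by blast
    then show False using g(3) by simp
  qed
  moreover have "distinct [p, q, t]" "distinct [p, - q, g]" using t g pq by simp_all
  ultimately show ?thesis using that t(1) g(1) by blast
qed

lemma common_nbr_through_centre:
  assumes "x \<in> L" "y \<in> L" "p \<in> x" "p \<in> y" "q \<in> x" "- q \<in> y"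
    "x \<inter> y = {p}" "adj x M" "adj y M" "p \<in> M" "e \<in> x" "e \<in> M"
  shows "e = p"
proof (rule ccontr)
  assume ep: "e \<noteq> p"
  have M: "M \<in> L" "x \<noteq> M" "y \<noteq> M" using assms adj_lines by auto
  have qp: "q \<noteq> p" "- q \<noteq> p" using assms no_opposite by force+
  obtain s where s: "x = {p, e, s}" "M = {p, e, - s}" "s \<noteq> p" "s \<noteq> e" "- s \<noteq> p" "- s \<noteq> e"
    using two_common[OF assms(1) M(1,2) _ assms(3,11,10,12)] ep by metis
  have "q = e \<or> q = s" using assms(5) s(1) qp by auto
  then show False
  proof
    assume "q = s"
    then obtain g where g: "y = {p, - q, g}" "M = {p, - q, - g}" 

    proof -
      have "- q \<in> M" using s \<open>q = s\<close> by simp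
      then show ?thesis
        using two_common[OF assms(2) M(1,3) _ assms(4,6,10)] qp(2) that by metis
    qed
    have "e \<in> {p, - q, - g}" using g(2) assms(12) by simp
    then have "e = - g" using s(4,6) \<open>q = s\<close> ep by auto
    then have "- e \<in> y" using g by auto
    then show False using opposite_unique[OF assms(1,2), of e q] assms s \<open>q = s\<close> by auto
  next
    assume "q = e"
    have "- (- q) \<in> M" using assms(12) \<open>q = e\<close> by simp
    from adj_opposite[OF assms(9,6) this]
    obtain a b where "a \<noteq> b" "y = {a, b, - q}" "M = {a, b, q}"
      by (metis add.inverse_inverse)

    moreover have "- s \<in> M" "- s \<noteq> q" using s \<open>q = e\<close> by auto
    ultimately have "- s \<in> y" by auto
    then show False using opposite_unique[OF assms(1,2), of s q] assms s \<open>q = e\<close> by auto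
  qed
qed

text \<open>
  Common neighbours of such a pair of lines usually pass through the common point; the exceptions
  pass through both third points, so there are at most two of them.
\<close>

lemma common_nbr_meeting:
  assumes "x \<in> L" "y \<in> L" "x = {p, q, t}" "y = {p, - q, g}" "x \<inter> y = {p}"
    "adj x M" "adj y M"
  shows "p \<in> M \<and> M \<inter> {q, - q, t, - t, g, - g} = {} \<or> M \<in> joining t g"
proof (cases "p \<in> M")
  case True
  have M: "M \<in> L" using assms adj_lines by auto
  have x: "e = p" if "e \<in> x" "e \<in> M" for e
    using common_nbr_through_centre[of x y p q M e] assms that True by auto
  have y: "e = p" if "e \<in> y" "e \<in> M" for e
    using common_nbr_through_centre[of y x p "- q" M e] assms that True by (auto simp: Int_commute)
  have "- e \<notin> M" if ex: "e \<in> x" for e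
  proof
    assume e: "- e \<in> M"
    obtain a b where "a \<noteq> b" "x = {a, b, e}" "M = {a, b, - e}"
      using adj_opposite[OF assms(6) ex e] .
    then show False using x[of a] x[of b] by auto
  qed
  moreover have "- e \<notin> M" if ex: "e \<in> y" for e
  proof
    assume e: "- e \<in> M"
    obtain a b where "a \<noteq> b" "y = {a, b, e}" "M = {a, b, - e}"
      using adj_opposite[OF assms(7) ex e] .
    then show False using y[of a] y[of b] by auto
  qed
  moreover have "q \<noteq> p" "t \<noteq> p" "g \<noteq> p" "- q \<noteq> p"
    using distinct_triple[of p q t] distinct_triple[of p "- q" g] card_line[OF assms(1)] card_line[OF assms(2)]
      assms(3,4) by metis+
  ultimately have "q \<notin> M" "- q \<notin> M" "t \<notin> M" "- t \<notin> M" "g \<notin> M" "- g \<notin> M"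
    using x[of q] x[of t] y[of "- q"] y[of g] assms(3,4) by (metis insertCI)+
  then have "M \<inter> {q, - q, t, - t, g, - g} = {}" by simp
  then show ?thesis using True by blast
next
  case False
  have M: "M \<in> L" using assms adj_lines by auto
  have "q \<notin> M"
  proof
    assume "q \<in> M"
    then obtain a b where "a \<noteq> b" "y = {a, b, - q}" "M = {a, b, q}"
      using adj_opposite[OF assms(7), of "- q"] assms(4) by auto
    moreover have "p \<in> y" "p \<noteq> - q" using assms(3,4) no_opposite[OF assms(1), of p] by auto
    ultimately show False using False by auto
  qed
  moreover have "- q \<notin> M"
  proof
    assume "- q \<in> M"
    then obtain a b where "a \<noteq> b" "x = {a, b, q}" "M = {a, b, - q}"
      using adj_opposite[OF assms(6), of q] assms(3) by auto
    moreover have "p \<in> x" "p \<noteq> q" using assms(3,4) no_opposite[OF assms(2), of p] by auto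
    ultimately show False using False by auto
  qed
  moreover obtain e where e: "e \<in> x" "e \<in> M" using adj_common[OF assms(6)] .
  moreover obtain e' where e': "e' \<in> y" "e' \<in> M" using adj_common[OF assms(7)] .
  moreover have "e \<in> {p, q, t}" "e' \<in> {p, - q, g}" using e(1) e'(1) assms(3,4) by simp_all
  ultimately have "t \<in> M" "g \<in> M" using False by blast+
  then show ?thesis using M unfolding joining_def by blast
qed

end

section \<open>Lines at distance two\<close>

lemma ex_not_in_smaller: "finite B \<Longrightarrow> card B < card A \<Longrightarrow> \<exists>a\<in>A. a \<notin> B"
  by (meson card_mono subsetI not_le)

text \<open>
  The hypotheses on the graph, in terms of lines. A graph that is not complete has vertices at
  distance two from every vertex, by regularity and connectedness; these are the only pairs on
  which the parameter \<open>c\<close> says anything.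
\<close>

locale sesqui_triples = signed_triples +
  fixes k c :: nat
  assumes connected: "l \<in> L \<Longrightarrow> m \<in> L \<Longrightarrow> adj\<^sup>*\<^sup>* l m"
    and regular: "l \<in> L \<Longrightarrow> card (nbrs l) = k"
    and sesqui: "adj l z \<Longrightarrow> adj z m \<Longrightarrow> l \<noteq> m \<Longrightarrow> \<not> adj l m \<Longrightarrow> card (nbrs l \<inter> nbrs m) = c"
    and c_ge: "9 \<le> c" and k_ge: "c + 2 \<le> k"
    and not_complete: "\<exists>l\<in>L. \<exists>m\<in>L. l \<noteq> m \<and> \<not> adj l m"
begin

lemma adj_tripleI:
  assumes "l = {a, b, d}" "l \<in> L" "m \<in> L" "l \<noteq> m" "a \<in> m" "- b \<notin> m" "- d \<notin> m"
  shows "adj l m"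
proof (rule adjI[OF assms(2-4) _ assms(5)])
  fix e assume "e \<in> l"
  then consider "e = a" | "e = b" | "e = d" using assms(1) by blast
  then show "- e \<notin> m" using assms(6,7) no_opposite[OF assms(3,5)] by cases simp_all
qed (simp add: assms(1))

lemma common_ge_9:
  assumes "adj l z" "adj z m" "l \<noteq> m" "\<not> adj l m"
  shows "9 \<le> card (nbrs l \<inter> nbrs m)"
  using sesqui[OF assms] c_ge by simp

lemma common_ge_9_disjoint:
  assumes "adj l z" "adj z m" "l \<inter> m = {}"
  shows "9 \<le> card (nbrs l \<inter> nbrs m)"
proof (rule common_ge_9[OF assms(1,2)])
  have "l \<noteq> {}" using adj_common[OF assms(1)] by blast
  then show "l \<noteq> m" using assms(3) by blast
qed (rule disjoint_not_adj[OF assms(3)])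

lemma ex_at_distance_two:
  assumes x: "x \<in> L"
  obtains y z where "adj x z" "adj z y" "x \<noteq> y" "\<not> adj x y"
proof (rule ccontr)
  note that' = that
  assume "\<not> thesis"
  then have no: "adj x m" if "adj x z" "adj z m" "x \<noteq> m" for z m using that that' by blast
  have "m \<in> insert x (nbrs x)" if "adj\<^sup>*\<^sup>* x m" for m
    using that
  proof induction
    case (step z m)
    then show ?case using no unfolding nbrs_def by blast
  qed simp
  then have "L \<subseteq> insert x (nbrs x)" using connected x by blast
  then have "card L \<le> card (insert x (nbrs x))" by (intro card_mono) auto
  also have "\<dots> \<le> k + 1" using regular[OF x] by (simp add: card_insert_if)
  finally have "card L \<le> k + 1" .
  moreover obtain l m where lm: "l \<in> L" "m \<in> L" "l \<noteq> m" "\<not> adj l m" using not_complete by blast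
  have "card (insert m (insert l (nbrs l))) \<le> card L"
    using lm finite_lines by (intro card_mono) (auto simp: nbrs_def adj_lines)
  moreover have "card (insert m (insert l (nbrs l))) = k + 2"
    using lm(3,4) regular[OF lm(1)] adj_lines(3)[of l l] finite_nbrs[of l]
    by (auto simp: nbrs_def card_insert_if)
  ultimately show False by linarith
qed

text \<open>
  The line \<open>z\<close> is a neighbour of a line joining \<open>a\<close> to \<open>b\<close> and of one joining \<open>d\<close> to \<open>e\<close>. Both lines
  have twins, and the points in which they differ from their twins are useless for common
  neighbours; only four pairs of points remain and account for at most eight common neighbours.
\<close>

lemma no_disjoint_twins:
  assumes ab: "2 \<le> card (joining a b)" and de: "2 \<le> card (joining d e)"
    and z: "z \<in> L" "a \<in> z" "d \<in> z" "a \<noteq> d" "b \<notin> z" "- b \<notin> z" "e \<notin> z" "- e \<notin> z" and "b \<noteq> e"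
  shows False
proof -
  have ne: "a \<noteq> b" "d \<noteq> e" "a \<noteq> e" "b \<noteq> d" using z by auto
  obtain t where t: "{a, b, t} \<in> L" "{a, b, - t} \<in> L" using joining_twins[OF ne(1) ab] by metis
  obtain s where s: "{d, e, s} \<in> L" "{d, e, - s} \<in> L" using joining_twins[OF ne(2) de] by metis
  have t': "w = {a, b, t}" if "w \<in> L" "t \<in> w" for w using twin_third_unique t that by blast
  have s': "w = {d, e, s}" if "w \<in> L" "s \<in> w" for w using twin_third_unique s that by blast
  have mt: "- t \<notin> z"
    using twin_third_unique[of a b "- t" z] t z by auto
  have ms: "- s \<notin> z"
    using twin_third_unique[of d e "- s" z] s z by auto
  have tz: "t \<notin> z" "s \<notin> z" using t'[OF z(1)] s'[OF z(1)] z by auto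
  have 1: "adj {a, b, t} z"
    using z(5) by (intro adj_tripleI[OF refl t(1) z(1) _ z(2,6) mt]) blast
  have 2: "adj {d, e, s} z"
    using z(7) by (intro adj_tripleI[OF refl s(1) z(1) _ z(3,8) ms]) blast
  have "t \<notin> {d, e, s}"
  proof
    assume "t \<in> {d, e, s}"
    then have eq: "{d, e, s} = {a, b, t}" by (rule t'[OF s(1)])
    have "d \<in> {a, b, t}" "e \<in> {a, b, t}" by (simp_all flip: eq)
    then show False using ne z(4) \<open>b \<noteq> e\<close> by auto
  qed
  moreover have "s \<notin> {a, b, t}"
  proof
    assume "s \<in> {a, b, t}"
    then have eq: "{a, b, t} = {d, e, s}" by (rule s'[OF t(1)])
    have "a \<in> {d, e, s}" "b \<in> {d, e, s}" by (simp_all flip: eq)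
    then show False using ne z(4) \<open>b \<noteq> e\<close> by auto
  qed
  ultimately have disj: "{a, b, t} \<inter> {d, e, s} = {}" using ne \<open>b \<noteq> e\<close> z(4) by auto
  have "nbrs {a, b, t} \<inter> nbrs {d, e, s} \<subseteq> joining a d \<union> joining a e \<union> (joining b d \<union> joining b e)"
  proof
    fix M assume M: "M \<in> nbrs {a, b, t} \<inter> nbrs {d, e, s}"
    then have "M \<in> L" "M \<noteq> {a, b, t}" "M \<noteq> {d, e, s}"
      unfolding nbrs_def using adj_lines by blast+
    then have "t \<notin> M" "s \<notin> M" using t' s' by blast+
    then show "M \<in> joining a d \<union> joining a e \<union> (joining b d \<union> joining b e)"
      using common_nbr_disjoint[OF t(1) s(1) disj M] by (auto simp: joining_def)
  qed
  then have "card (nbrs {a, b, t} \<inter> nbrs {d, e, s}) 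
      \<le> card (joining a d \<union> joining a e \<union> (joining b d \<union> joining b e))" by (intro card_mono) auto
  also have "\<dots> \<le> card (joining a d) + card (joining a e) + (card (joining b d) + card (joining b e))"
    by (intro order.trans[OF card_Un_le] add_mono card_Un_le)
  also have "\<dots> \<le> 8"
    using card_joining[of a d] card_joining[of a e] card_joining[of b d] card_joining[of b e] ne z(4) \<open>b \<noteq> e\<close> by linarith
  finally show False using common_ge_9_disjoint[OF 1 adj_sym[OF 2] disj] by simp
qed

section \<open>Disjoint lines at distance two exist\<close>

text \<open>
  Assume that every line at distance two from \<open>x\<close> meets \<open>x\<close>, and let \<open>y\<close> be one of them, with
  common point \<open>p\<close> and opposite pair \<open>q\<close>, \<open>- q\<close>. Then \<open>p\<close> is on many lines, and it turns out
  to be on all of them, which makes the graph too dense for \<open>c + 2 \<le> k\<close>.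
\<close>

context
  fixes x y :: "int set" and p q t g :: int
  assumes x: "x \<in> L" "x = {p, q, t}" and y: "y \<in> L" "y = {p, - q, g}"
    and xy: "x \<inter> y = {p}" "distinct [p, q, t]" "distinct [p, - q, g]" "g \<notin> x" "- g \<notin> x"
    and nonadj: "\<not> adj x y" and two: "\<exists>z. adj x z \<and> adj z y"
    and meet: "\<And>M z. adj x M \<Longrightarrow> adj M z \<Longrightarrow> x \<inter> z \<noteq> {}"
begin

definition central where "central = {M \<in> through p. M \<inter> {q, - q, t, - t, g, - g} = {}}"

lemma x_ne_y: "x \<noteq> y"
proof
  assume "x = y"
  then have "x = {p}" using xy(1) by simp
  then show False using card_line[OF x(1)] by simp
qed

lemma finite_central: "finite central" by (auto simp: central_def)

text \<open>
  Of the at least nine common neighbours of \<open>x\<close> and \<open>y\<close>, at most two join \<open>t\<close> to \<open>g\<close>.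
\<close>

lemma card_central: "7 \<le> card central"
proof -
  have "nbrs x \<inter> nbrs y \<subseteq> central \<union> joining t g"
  proof
    fix M assume "M \<in> nbrs x \<inter> nbrs y"
    then have M: "adj x M" "adj y M" by (auto simp: nbrs_def)
    then have "M \<in> L" using adj_lines by blast
    then show "M \<in> central \<union> joining t g"
      using common_nbr_meeting[OF x(1) y(1) x(2) y(2) xy(1) M] unfolding central_def through_def by blast
  qed
  then have "card (nbrs x \<inter> nbrs y) \<le> card (central \<union> joining t g)" using finite_central by (intro card_mono) auto
  also have "\<dots> \<le> card central + card (joining t g)" by (rule card_Un_le)
  finally have "9 \<le> card central + card (joining t g)" using common_ge_9 two x_ne_y nonadj by (meson order.trans)
  moreover have "t \<noteq> g" using xy(4) x(2) by auto
  then have "card (joining t g) \<le> 2" by (rule card_joining)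
  ultimately show ?thesis by linarith
qed

lemma p_unopposed: "l \<in> L \<Longrightarrow> - p \<notin> l"
proof
  assume l: "l \<in> L" "- p \<in> l"
  have "card central \<le> card (through p)" by (intro card_mono) (auto simp: central_def)
  then show False using card_central card_through_opposite[OF l] by linarith
qed

lemma central_adj:
  assumes "l \<in> central" shows "adj x l"
proof -
  have l: "l \<in> L" "p \<in> l" "q \<notin> l" "- q \<notin> l" "- t \<notin> l" using assms by (auto simp: central_def through_def)
  have "x \<noteq> l" using l(3) x(2) by blast
  then show ?thesis by (rule adj_tripleI[OF x(2,1) l(1) _ l(2,4,5)])
qed

text \<open>
  At most four lines join \<open>p\<close> to \<open>i\<close> or \<open>j\<close>.
\<close>

lemma ex_central_avoiding:
  assumes "p \<notin> {i, j}"
  obtains l where "l \<in> central" "l \<inter> {q, t, g, i, j} = {}"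
proof -
  have "card {l \<in> through p. l \<inter> {i, j} \<noteq> {}} \<le> 2 * card {i, j}"
    by (rule card_through_meeting[OF assms]) simp
  also have "\<dots> \<le> 4" by (simp add: card_insert_if)
  finally have "card {l \<in> through p. l \<inter> {i, j} \<noteq> {}} < card central" using card_central by linarith
  then obtain l where "l \<in> central" "l \<notin> {l \<in> through p. l \<inter> {i, j} \<noteq> {}}"
    using ex_not_in_smaller[of "{l \<in> through p. l \<inter> {i, j} \<noteq> {}}" central] by auto
  then have "l \<in> central" "l \<inter> {q, t, g, i, j} = {}" by (auto simp: central_def)
  then show ?thesis by (rule that)
qed

lemma configuration_points: "p \<in> x" "q \<in> x" "t \<in> x" "p \<in> y" "- q \<in> y" "g \<in> y" 
  "p \<noteq> q" "p \<noteq> t" "q \<noteq> t" "p \<noteq> - q" "p \<noteq> g" "- q \<noteq> g"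
  using x(2) y(2) xy(2,3) by auto

lemma joining_pt: "M \<in> L \<Longrightarrow> p \<in> M \<Longrightarrow> t \<in> M \<Longrightarrow> M = x"
proof (rule ccontr)
  assume M: "M \<in> L" "p \<in> M" "t \<in> M" "M \<noteq> x"
  then obtain r where r: "x = {p, t, r}" "M = {p, t, - r}"
    using two_common[OF x(1) M(1) M(4)[symmetric] configuration_points(8,1,3) M(2,3)] by metis
  have "q \<in> {p, t, r}" using r(1) configuration_points(2) by blast
  then have "r = q" using configuration_points(7,9) by simp
  then have mq: "- q \<in> M" using r by simp
  have "t \<notin> y" using xy(1) configuration_points(3,8) by auto
  then have "y \<noteq> M" using M(3) by blast
  then obtain s where s: "y = {p, - q, s}" "M = {p, - q, - s}" "- s \<noteq> p" "- s \<noteq> - q"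
    using two_common[OF y(1) M(1) _ configuration_points(10,4,5) M(2) mq] by metis
  have "g \<in> {p, - q, s}" using s(1) configuration_points(6) by blast
  then have "s = g" using configuration_points(11,12) by simp
  moreover have "- s \<in> {p, t, - r}" using s(2) r(2) by blast
  ultimately have "- g = t" using s(3,4) \<open>r = q\<close> by simp
  then show False using xy(5) configuration_points(3) by simp
qed

lemma joining_pg: "M \<in> L \<Longrightarrow> p \<in> M \<Longrightarrow> g \<in> M \<Longrightarrow> M = y"
proof (rule ccontr)
  assume M: "M \<in> L" "p \<in> M" "g \<in> M" "M \<noteq> y"
  then obtain r where r: "y = {p, g, r}" "M = {p, g, - r}"
    using two_common[OF y(1) M(1) M(4)[symmetric] configuration_points(11,4,6) M(2,3)] by metis
  have "- q \<in> {p, g, r}" using r(1) configuration_points(5) by blast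
  then have "r = - q" using configuration_points(10,12) by simp
  then have mq: "q \<in> M" using r by simp
  have "x \<noteq> M" using M(3) xy(4) by blast
  then obtain s where s: "x = {p, q, s}" "M = {p, q, - s}"
    using two_common[OF x(1) M(1) _ configuration_points(7,1,2) M(2) mq] by metis
  have "g \<noteq> q" using xy(4) configuration_points(2) by blast
  moreover have "g \<in> {p, q, - s}" using M(3) s(2) by blast
  ultimately have "g = - s" using configuration_points(11) by simp
  then show False using xy(5) s(1) by simp
qed

lemma nbr_off_p_no_opposite:
  assumes "adj x w" "p \<notin> w" "e \<in> x"
  shows "- e \<notin> w"
proof
  assume e: "- e \<in> w"
  obtain a b where "a \<noteq> b" "x = {a, b, e}" "w = {a, b, - e}" using adj_opposite[OF assms(1,3) e] .
  then have "p = e" using assms(2) x(2) by auto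
  then show False using p_unopposed adj_lines(2)[OF assms(1)] e by blast
qed

lemma g_on_lines_through_q:
  assumes "w \<in> L" "q \<in> w" "p \<notin> w"
  shows "g \<in> w"
proof -
  have "- q \<in> y" using y by simp
  then obtain e where "e \<in> w" "e \<in> y" using opposite_imp_common[OF assms(1) y(1) assms(2)] by blast
  moreover have "- q \<notin> w" using no_opposite assms by blast
  ultimately show ?thesis using y(2) assms(3) by auto
qed

text \<open>
  A neighbour \<open>w\<close> of \<open>x\<close> through \<open>q\<close> and off \<open>p\<close> contains \<open>g\<close>, because of \<open>y\<close>. It is at distance two
  from a central line \<open>l\<close> disjoint from it. A common neighbour of \<open>l\<close> and \<open>w\<close> is at distance at most
  two from \<open>x\<close>, so it meets \<open>x\<close>, and this leaves room for only eight of them.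
\<close>

lemma no_nbr_at_q:
  assumes w: "adj x w" "p \<notin> w" "q \<in> w"
  shows False
proof -
  have wL: "w \<in> L" using w adj_lines by blast
  have gw: "g \<in> w" using g_on_lines_through_q wL w by blast
  have "q \<noteq> g" using xy(4) x(2) by auto
  then obtain j where j: "w = {q, g, j}" using line_cases_pair[OF wL w(3) gw] by metis
  then have "p \<notin> {g, j}" using w by auto
  then obtain l where l: "l \<in> central" "l \<inter> {q, t, g, g, j} = {}" using ex_central_avoiding[of g j] by auto
  then have lw: "l \<inter> w = {}" using j by auto
  have lL: "l \<in> L" "p \<in> l" using l by (auto simp: central_def through_def)
  obtain s s' where s: "l = {p, s, s'}" using line_cases_point[OF lL] by metis
  have sub: "nbrs l \<inter> nbrs w \<subseteq> joining p q \<union> joining p j \<union> (joining s t \<union> joining s' t)"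
  proof
    fix M assume "M \<in> nbrs l \<inter> nbrs w"
    then have M: "adj l M" "adj w M" by (auto simp: nbrs_def)
    have M1: "M \<in> L" "l \<noteq> M" "w \<noteq> M" using M adj_lines by auto
    obtain i where i: "i \<in> l" "i \<in> M" using adj_common[OF M(1)] .
    obtain i' where i': "i' \<in> w" "i' \<in> M" using adj_common[OF M(2)] .
    show "M \<in> joining p q \<union> joining p j \<union> (joining s t \<union> joining s' t)"
    proof (cases "p \<in> M")
      case True
      have "i' \<noteq> g"
      proof
        assume "i' = g"
        then have "M = y" using joining_pg[OF M1(1) True] i' by simp
        then have "- q \<in> M" using y(2) by simp
        from adj_opposite[OF M(2) w(3) this]
        obtain a b where "a \<noteq> b" "w = {a, b, q}" "M = {a, b, - q}" .
        then have "p = - q" using True w(2) by auto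
        then show False using xy(3) by simp
      qed
      then have "i' = q \<or> i' = j" using i' j by simp
      then show ?thesis using True i' M1 by (auto simp: joining_def)
    next
      case False
      then have iss: "i = s \<or> i = s'" using i s by auto
      obtain e where e: "e \<in> x" "e \<in> M" using meet[OF central_adj[OF l(1)] M(1)] by blast
      have "e \<noteq> q"
      proof
        assume "e = q"
        then have "q \<in> M" "g \<in> M" using e g_on_lines_through_q M1 False by auto
        then obtain r where r: "w = {q, g, r}" "M = {q, g, - r}"
          using two_common[OF wL M1(1,3) \<open>q \<noteq> g\<close> w(3) gw] by metis
        have "i \<notin> w" using i lw by auto
        then have "i = - r" using r i by auto
        then have "- i \<in> w" using r by simp
        then show False using disjoint_opposite[OF lL(1) wL lw i(1)] by blast
      qed
      then have "e = t" using e False x(2) by auto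
      then show ?thesis using iss e M1 i by (auto simp: joining_def)
    qed
  qed
  have "p \<noteq> q" "p \<noteq> j" using xy(2) w j by auto
  moreover have "t \<noteq> s" "t \<noteq> s'" using l(1) s by (auto simp: central_def)
  ultimately have le: "card (joining p q) \<le> 2" "card (joining p j) \<le> 2" "card (joining s t) \<le> 2" "card (joining s' t) \<le> 2"
    using card_joining by metis+
  have "card (nbrs l \<inter> nbrs w) \<le> card (joining p q \<union> joining p j \<union> (joining s t \<union> joining s' t))"
    using sub by (intro card_mono) auto
  also have "\<dots> \<le> card (joining p q) + card (joining p j) + (card (joining s t) + card (joining s' t))"
    by (intro order.trans[OF card_Un_le] add_mono card_Un_le)
  finally show False
    using le common_ge_9_disjoint[OF adj_sym[OF central_adj[OF l(1)]] w(1) lw] by linarith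
qed

text \<open>
  The same comparison of \<open>w\<close> with a disjoint central line \<open>l\<close>. Now the count reaches nine only if
  \<open>p\<close> is joined by twins to a point of \<open>w\<close>, and \<open>t\<close> to a point of \<open>l\<close>; these two pairs of twins
  are disjoint and have the common neighbour \<open>x\<close>.
\<close>

lemma no_nbr_at_t:
  assumes w: "adj x w" "p \<notin> w" "t \<in> w"
  shows False
proof -
  have wL: "w \<in> L" using w adj_lines by blast
  have qw: "q \<notin> w" using no_nbr_at_q w by blast
  obtain i j where ij: "w = {t, i, j}" "t \<noteq> i" "t \<noteq> j" "i \<noteq> j" using line_cases_point[OF wL w(3)] by metis
  then have "p \<notin> {i, j}" using w by auto
  then obtain l where l: "l \<in> central" "l \<inter> {q, t, g, i, j} = {}" using ex_central_avoiding[of i j] by auto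
  then have lw: "l \<inter> w = {}" using ij by auto
  have lL: "l \<in> L" "p \<in> l" "q \<notin> l" "g \<notin> l" "t \<notin> l" "- q \<notin> l" "- t \<notin> l" using l by (auto simp: central_def through_def)
  obtain s s' where s: "l = {p, s, s'}" "p \<noteq> s" "p \<noteq> s'" using line_cases_point[OF lL(1,2)] by metis
  \<comment> \<open>A common neighbour of \<open>l\<close> and \<open>w\<close> through neither \<open>p\<close> nor \<open>t\<close> passes through \<open>q\<close> and hence \<open>g\<close>.
    There is at most one, since twins differ in opposite points and \<open>l\<close> does not contain both.\<close>
  define E where "E = {M \<in> joining q g. M \<inter> l \<noteq> {}}"
  have qg: "q \<noteq> g" using xy(4) x(2) by auto
  have E: "card E \<le> 1"
  proof -
    have "M = M'" if MM: "M \<in> E" "M' \<in> E" for M M'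
    proof (rule ccontr)
      assume ne: "M \<noteq> M'"
      have M: "M \<in> L" "q \<in> M" "g \<in> M" "M' \<in> L" "q \<in> M'" "g \<in> M'" using MM by (auto simp: E_def joining_def)
      obtain r where r: "M = {q, g, r}" "M' = {q, g, - r}"
        using two_common[OF M(1,4) ne qg M(2,3,5,6)] by metis
      have "M \<inter> l \<noteq> {}" "M' \<inter> l \<noteq> {}" using MM by (auto simp: E_def)
      then have "r \<in> l" "- r \<in> l" using r lL by auto
      then show False using no_opposite[OF lL(1)] by blast
    qed
    moreover have "finite E" by (auto simp: E_def)
    ultimately show ?thesis using card_le_Suc0_iff_eq[of E] by auto
  qed
  have sub: "nbrs l \<inter> nbrs w \<subseteq> joining p i \<union> joining p j \<union> (joining t s \<union> joining t s') \<union> ({x} \<union> E)"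
  proof
    fix M assume "M \<in> nbrs l \<inter> nbrs w"
    then have M: "adj l M" "adj w M" by (auto simp: nbrs_def)
    have M1: "M \<in> L" "l \<noteq> M" "w \<noteq> M" using M adj_lines by auto
    obtain u where u: "u \<in> l" "u \<in> M" using adj_common[OF M(1)] .
    obtain v where v: "v \<in> w" "v \<in> M" using adj_common[OF M(2)] .
    show "M \<in> joining p i \<union> joining p j \<union> (joining t s \<union> joining t s') \<union> ({x} \<union> E)"
    proof (cases "p \<in> M")
      case True
      have "v = t \<or> v = i \<or> v = j" using v ij by simp
      then show ?thesis using True v M1 joining_pt[OF M1(1) True] by (auto simp: joining_def)
    next
      case False
      then have uss: "u = s \<or> u = s'" using u s by auto
      obtain e where e: "e \<in> x" "e \<in> M" using meet[OF central_adj[OF l(1)] M(1)] by blast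
      then have "e = q \<or> e = t" using False x(2) by auto
      then show ?thesis
      proof
        assume "e = q"
        then have "g \<in> M" using g_on_lines_through_q[OF M1(1)] e False by simp
        then show ?thesis using e u M1 \<open>e = q\<close> by (auto simp: E_def joining_def)
      next
        assume "e = t"
        then show ?thesis using uss e M1 u by (auto simp: joining_def)
      qed
    qed
  qed
  have "card (nbrs l \<inter> nbrs w) \<le> card (joining p i \<union> joining p j \<union> (joining t s \<union> joining t s') \<union> ({x} \<union> E))"
    using sub by (intro card_mono) (auto simp: E_def)
  also have "\<dots> \<le> card (joining p i) + card (joining p j) + (card (joining t s) + card (joining t s')) + (card {x} + card E)"
    by (intro order.trans[OF card_Un_le] add_mono card_Un_le)
  finally have ge: "7 \<le> card (joining p i) + card (joining p j) + (card (joining t s) + card (joining t s'))"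
    using E common_ge_9_disjoint[OF adj_sym[OF central_adj[OF l(1)]] w(1) lw] by simp
  have "p \<noteq> i" "p \<noteq> j" "t \<noteq> s" "t \<noteq> s'" using w ij s lL by auto
  then have le: "card (joining p i) \<le> 2" "card (joining p j) \<le> 2" "card (joining t s) \<le> 2" "card (joining t s') \<le> 2"
    using card_joining by metis+
  obtain i' where i': "i' \<in> {i, j}" "2 \<le> card (joining p i')"
  proof -
    have "2 \<le> card (joining p i) \<or> 2 \<le> card (joining p j)" using ge le by linarith
    then show ?thesis using that by blast
  qed
  obtain u where u: "u \<in> {s, s'}" "2 \<le> card (joining t u)"
  proof -
    have "2 \<le> card (joining t s) \<or> 2 \<le> card (joining t s')" using ge le by linarith
    then show ?thesis using that by blast
  qed
  have iw: "i' \<in> w" "i' \<noteq> t" using i' ij by auto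
  have ul: "u \<in> l" "u \<noteq> p" using u s by auto
  have "i' \<notin> x" using iw x(2) w qw by auto
  moreover have "- i' \<notin> x"
  proof
    assume "- i' \<in> x"
    then show False using nbr_off_p_no_opposite[OF w(1,2), of "- i'"] iw by simp
  qed
  moreover have "u \<notin> x" using ul lL x(2) by auto
  moreover have "- u \<notin> x"
  proof
    assume "- u \<in> x"
    then have "u = - p \<or> u = - q \<or> u = - t" using x(2) by auto
    then show False using ul lL p_unopposed[OF lL(1)] by auto
  qed
  moreover have "i' \<noteq> u" using iw ul lw by auto
  moreover have "p \<in> x" "t \<in> x" "p \<noteq> t" using x(2) xy(2) by auto
  ultimately show False using no_disjoint_twins[OF i'(2) u(2) x(1)] by blast
qed

lemma nbr_through_p: "adj x w \<Longrightarrow> p \<in> w"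
  using adj_common[of x w] no_nbr_at_q[of w] no_nbr_at_t[of w] x(2) by blast

text \<open>
  If \<open>u\<close> missed \<open>p\<close>, it would be at distance two from \<open>x\<close>. All common neighbours of \<open>x\<close> and \<open>u\<close> pass
  through \<open>p\<close> and a point of \<open>u\<close>, so there are at most six.
\<close>

lemma through_p_of_nbr:
  assumes "adj x M" "adj M u"
  shows "p \<in> u"
proof (rule ccontr)
  assume pu: "p \<notin> u"
  have "x \<noteq> u" "\<not> adj x u" using pu x(2) nbr_through_p by auto
  then have "9 \<le> card (nbrs x \<inter> nbrs u)" using common_ge_9[OF assms] by blast
  also have "nbrs x \<inter> nbrs u \<subseteq> {l \<in> through p. l \<inter> u \<noteq> {}}"
    using nbr_through_p by (auto simp: nbrs_def through_def adj_lines elim: adj_common)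
  then have "card (nbrs x \<inter> nbrs u) \<le> card {l \<in> through p. l \<inter> u \<noteq> {}}" by (intro card_mono) auto
  also have "\<dots> \<le> 2 * card u"
    using card_through_meeting[OF pu] finite_line adj_lines assms by blast
  finally show False using card_line[of u] adj_lines(2)[OF assms(2)] by simp
qed

text \<open>
  By connectedness it suffices to consider \<open>w\<close> adjacent to a line \<open>l0\<close> through \<open>p\<close>. Some central
  line \<open>l'\<close> is adjacent to \<open>l0\<close>. Were \<open>p\<close> not on \<open>w\<close>, the common neighbours of \<open>l'\<close> and \<open>w\<close> would again
  pass through \<open>p\<close> and meet \<open>w\<close>.
\<close>

lemma all_through_p:
  assumes "l \<in> L" shows "p \<in> l"
proof -
  have "adj\<^sup>*\<^sup>* x l" using connected x assms by blast
  then show ?thesis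
  proof induction
    case base show ?case using x by simp
  next
    case (step l0 w)
    show ?case
    proof (rule ccontr)
      assume pw: "p \<notin> w"
      have l0: "l0 \<in> L" "p \<in> l0" using step adj_lines by auto
      obtain e e' where e: "l0 = {p, e, e'}" using line_cases_point[OF l0] by metis
      have pe: "p \<notin> {- e, - e'}" using e p_unopposed[OF l0(1)] by (auto simp: minus_equation_iff)
      have "card {l \<in> through p. l \<inter> {- e, - e'} \<noteq> {}} \<le> 2 * card {- e, - e'}"
        by (rule card_through_meeting[OF pe]) simp
      also have "\<dots> \<le> 4" by (simp add: card_insert_if)
      finally have "card (insert l0 {l \<in> through p. l \<inter> {- e, - e'} \<noteq> {}}) < card central"
        using card_central by (simp add: card_insert_if)
      then obtain l' where "l' \<in> central" "l' \<notin> insert l0 {l \<in> through p. l \<inter> {- e, - e'} \<noteq> {}}"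
        using ex_not_in_smaller[of "insert l0 {l \<in> through p. l \<inter> {- e, - e'} \<noteq> {}}" central] by auto
      then have l': "l' \<in> central" "l' \<noteq> l0" "- e \<notin> l'" "- e' \<notin> l'" by (auto simp: central_def)
      have l'L: "l' \<in> L" "p \<in> l'" using l'(1) by (auto simp: central_def through_def)
      have xl': "adj x l'" by (rule central_adj[OF l'(1)])
      have "adj l0 l'"
        by (rule adj_tripleI[OF e l0(1) l'L(1) l'(2)[symmetric] l'L(2) l'(3,4)])
      moreover have "l' \<noteq> w" "\<not> adj l' w" using pw l'L(2) through_p_of_nbr[OF xl'] by auto
      ultimately have "9 \<le> card (nbrs l' \<inter> nbrs w)" using common_ge_9 step(2) adj_sym by blast
      also have "nbrs l' \<inter> nbrs w \<subseteq> {l \<in> through p. l \<inter> w \<noteq> {}}"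
        using through_p_of_nbr[OF xl'] by (auto simp: nbrs_def through_def adj_lines elim: adj_common)
      then have "card (nbrs l' \<inter> nbrs w) \<le> card {l \<in> through p. l \<inter> w \<noteq> {}}" by (intro card_mono) auto
      also have "\<dots> \<le> 2 * card w"
        using card_through_meeting[OF pw] finite_line adj_lines step by blast
      finally show False using card_line[of w] adj_lines(2)[OF step(2)] by simp
    qed
  qed
qed

definition nonnbrs where "nonnbrs l = L - insert l (nbrs l)"

lemma card_nonnbrs:
  assumes "l \<in> L" shows "card (nonnbrs l) = card L - Suc k"
proof -
  have "insert l (nbrs l) \<subseteq> L" using assms adj_lines by (auto simp: nbrs_def)
  moreover have "card (insert l (nbrs l)) = Suc k"
    using regular[OF assms] adj_lines(3)[of l l] finite_nbrs[of l] by (auto simp: nbrs_def card_insert_if)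
  ultimately show ?thesis unfolding nonnbrs_def by (simp add: card_Diff_subset)
qed

lemma nonnbrs_opposite:
  assumes "l \<in> L" "m \<in> nonnbrs l"
  obtains e where "e \<in> l" "- e \<in> m" "e \<noteq> p"
proof -
  have m: "m \<in> L" "l \<noteq> m" "\<not> adj l m" using assms by (auto simp: nonnbrs_def nbrs_def)
  then obtain e where "e \<in> l" "- e \<in> m" using adjI[OF assms(1) m(1,2), of p] all_through_p assms(1) by blast
  then show ?thesis using that p_unopposed m by blast
qed

text \<open>
  A line that is not adjacent to \<open>{p, a, b}\<close> joins \<open>p\<close> to \<open>- a\<close> or \<open>- b\<close>, so three of them would
  include twins. But a line with a twin has at most two nonneighbours, as the opposite of one of
  its points lies on its twin alone; regularity carries this bound to all lines.
\<close>

lemma card_nonnbrs_le: "card L - Suc k \<le> 2"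
proof (rule ccontr)
  assume gt: "\<not> card L - Suc k \<le> 2"
  have "\<exists>e\<in>x. e \<noteq> p \<and> 2 \<le> card (joining p (- e))"
  proof (rule ccontr)
    assume "\<not> ?thesis"
    then have le: "card (joining p (- q)) \<le> 1" "card (joining p (- t)) \<le> 1" using x(2) xy(2) by force+
    have "nonnbrs x \<subseteq> joining p (- q) \<union> joining p (- t)"
    proof
      fix m assume m: "m \<in> nonnbrs x"
      then have "m \<in> L" by (simp add: nonnbrs_def)
      then show "m \<in> joining p (- q) \<union> joining p (- t)"
        using nonnbrs_opposite[OF x(1) m] all_through_p x(2) by (auto simp: joining_def)
    qed
    then have "card (nonnbrs x) \<le> card (joining p (- q) \<union> joining p (- t))" by (intro card_mono) auto
    also have "\<dots> \<le> card (joining p (- q)) + card (joining p (- t))" by (rule card_Un_le)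
    finally show False using le gt card_nonnbrs[OF x(1)] by linarith
  qed
  then obtain e where e: "e \<in> x" "e \<noteq> p" "2 \<le> card (joining p (- e))" by blast
  have pe: "p \<noteq> - e" "p \<noteq> e" using p_unopposed[OF x(1)] e by auto
  obtain r where r: "{p, - e, r} \<in> L" "{p, - e, - r} \<in> L" using joining_twins[OF pe(1) e(3)] by metis
  have "nonnbrs {p, - e, r} \<subseteq> joining p e"
  proof
    fix m assume m: "m \<in> nonnbrs {p, - e, r}"
    then have mL: "m \<in> L" "m \<noteq> {p, - e, r}" "\<not> adj {p, - e, r} m" by (auto simp: nonnbrs_def nbrs_def)
    obtain f where f: "f \<in> {p, - e, r}" "- f \<in> m" "f \<noteq> p" using nonnbrs_opposite[OF r(1) m] .
    have "f \<noteq> r"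
    proof
      assume "f = r"
      then have "m = {p, - e, - r}" using twin_third_unique[of p "- e" "- r" m] r mL f by simp
      moreover have "adj {p, - e, r} {p, - e, - r}"
        by (rule adjI2[OF r _ pe(1)]) (use mL calculation in auto)
      ultimately show False using mL by simp
    qed
    then show "m \<in> joining p e" using f all_through_p mL by (auto simp: joining_def)
  qed
  then have "card (nonnbrs {p, - e, r}) \<le> card (joining p e)" by (intro card_mono) auto
  then show False using card_joining[OF pe(2)] gt card_nonnbrs[OF r(1)] by simp
qed

text \<open>
  A neighbour of \<open>x\<close> that is not a neighbour of \<open>y\<close> is a nonneighbour of \<open>y\<close> other than \<open>x\<close>. There is
  at most one, whence \<open>k \<le> c + 1\<close>.
\<close>

lemma meeting_configuration_impossible: False
proof -
  have fin: "finite (nonnbrs y)" unfolding nonnbrs_def using finite_lines by simp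
  have xn: "x \<in> nonnbrs y" 
    unfolding nonnbrs_def nbrs_def using x(1) x_ne_y nonadj adj_sym by blast
  have "nbrs x \<subseteq> (nbrs x \<inter> nbrs y) \<union> (nonnbrs y - {x})"
    unfolding nonnbrs_def nbrs_def using adj_lines(2,3) nonadj by blast
  then have "card (nbrs x) \<le> card ((nbrs x \<inter> nbrs y) \<union> (nonnbrs y - {x}))"
    using fin by (intro card_mono) auto
  also have "\<dots> \<le> card (nbrs x \<inter> nbrs y) + card (nonnbrs y - {x})" by (rule card_Un_le)
  also have "card (nonnbrs y - {x}) = card (nonnbrs y) - 1" using xn fin by simp
  also have "card (nbrs x \<inter> nbrs y) = c" using sesqui two x_ne_y nonadj by blast
  finally show False using regular[OF x(1)] card_nonnbrs[OF y(1)] card_nonnbrs_le k_ge by linarith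
qed

end

lemma ex_disjoint_at_distance_two:
  assumes x: "x \<in> L"
  obtains z M where "adj x M" "adj M z" "x \<inter> z = {}"
proof (rule ccontr)
  assume no: "\<not> thesis"
  obtain y z where yz: "adj x z" "adj z y" "x \<noteq> y" "\<not> adj x y" using ex_at_distance_two[OF x] .
  have y: "y \<in> L" using yz adj_lines by blast
  have "x \<inter> y \<noteq> {}" using no that yz by blast
  then obtain p q t g where pq: "x = {p, q, t}" "y = {p, - q, g}" "x \<inter> y = {p}"
    "distinct [p, q, t]" "distinct [p, - q, g]" "g \<notin> x" "- g \<notin> x"
    using nonadj_meeting[OF x y yz(3,4)] by metis
  show False
    by (rule meeting_configuration_impossible[OF x pq(1) y pq(2-7) yz(4)]) (use yz no that in blast)+
qed

end

section \<open>Twins do not occur\<close>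

text \<open>
  Weights at most two on the edges between \<open>{a, b}\<close> and three further vertices, where an edge of
  weight two at \<open>a\<close> and one at \<open>b\<close> always share their other end. A total of nine forces the edges of
  weight two to be the three edges at one of \<open>a\<close> and \<open>b\<close>.
\<close>

lemma two_stars_arith:
  fixes a1 a2 a3 b1 b2 b3 :: nat
  assumes "9 \<le> (a1 + b1) + ((a2 + b2) + (a3 + b3))"
    "a1 \<le> 2" "b1 \<le> 2" "a2 \<le> 2" "b2 \<le> 2" "a3 \<le> 2" "b3 \<le> 2"
    "\<not> (2 \<le> a1 \<and> 2 \<le> b2)" "\<not> (2 \<le> a1 \<and> 2 \<le> b3)" "\<not> (2 \<le> a2 \<and> 2 \<le> b3)"
    "\<not> (2 \<le> a2 \<and> 2 \<le> b1)" "\<not> (2 \<le> a3 \<and> 2 \<le> b1)" "\<not> (2 \<le> a3 \<and> 2 \<le> b2)"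
  shows "(a1 = 2 \<and> b1 = 1 \<and> a2 = 2 \<and> b2 = 1 \<and> a3 = 2 \<and> b3 = 1) \<or>
    (a1 = 1 \<and> b1 = 2 \<and> a2 = 1 \<and> b2 = 2 \<and> a3 = 1 \<and> b3 = 2)"
  using assms by (cases "2 \<le> a1"; cases "2 \<le> a2"; cases "2 \<le> b1"; auto)

context sesqui_triples
begin

lemma joining_commute: "joining a b = joining b a"
  by (auto simp: joining_def)

text \<open>
  A common neighbour of a line \<open>l\<close> that has a twin and a line \<open>z\<close> disjoint from \<open>l\<close> joins \<open>a\<close> or \<open>b\<close> to a point of
  \<open>z\<close>. These are six pairs of points for at least nine lines, and the pairs joined by twins
  pairwise share a point by \<open>no_disjoint_twins\<close>.
\<close>

lemma twin_star:
  assumes ab: "a \<noteq> b" "2 \<le> card (joining a b)" and l: "l \<in> joining a b"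
    and z: "adj l M" "adj M z" "a \<notin> z" "b \<notin> z"
  shows "(\<forall>j\<in>z. card (joining a j) = 2 \<and> card (joining b j) = 1) \<or>
    (\<forall>j\<in>z. card (joining a j) = 1 \<and> card (joining b j) = 2)"
proof -
  have zL: "z \<in> L" using z adj_lines by blast
  obtain t where t: "l = {a, b, t}" "joining a b \<subseteq> {{a, b, t}, {a, b, - t}}"
    using joining_cases[OF l ab(1)] by metis
  obtain s where s: "{a, b, s} \<in> L" "{a, b, - s} \<in> L" "joining a b = {{a, b, s}, {a, b, - s}}"
    using joining_twins[OF ab] by metis
  have lL: "l \<in> L" using l by (simp add: joining_def)
  have third: "w = l" if "w \<in> L" "t \<in> w" for w
  proof -
    have "t \<noteq> a" "t \<noteq> b" using distinct_triple card_line[OF lL] t(1) by metis+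
    moreover have "l = {a, b, s} \<or> l = {a, b, - s}" using l s(3) by simp
    then have "t \<in> {a, b, s} \<or> t \<in> {a, b, - s}" using t(1) by auto
    ultimately have "t = s \<or> t = - s" by blast
    then show ?thesis
    proof
      assume "t = s"
      then show ?thesis using twin_third_unique[OF s(1,2) that(1)] that(2) t(1) by simp
    next
      assume ts: "t = - s"
      then have "{a, b, - (- s)} \<in> L" "- s \<in> w" using s(1) that(2) by simp_all
      then show ?thesis using twin_third_unique[OF s(2) _ that(1)] t(1) ts by simp
    qed
  qed
  have disj: "l \<inter> z = {}"
    using third[OF zL] z t(1) by auto
  have opp: "- j \<notin> l" if "j \<in> z" for j
    using disjoint_opposite[OF zL lL _ that] disj by blast
  have abl: "a \<in> l" "b \<in> l" using t by auto
  have star: "\<not> (2 \<le> card (joining a j) \<and> 2 \<le> card (joining b j'))"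
    if "j \<in> z" "j' \<in> z" "j \<noteq> j'" for j j'
    using no_disjoint_twins[of a j b j' l] lL abl ab(1) opp that disj by blast
  have le: "card (joining a j) \<le> 2" "card (joining b j) \<le> 2" if "j \<in> z" for j
    using card_joining that z(3,4) by metis+
  have sub: "nbrs l \<inter> nbrs z \<subseteq> (\<Union>j\<in>z. joining a j \<union> joining b j)"
  proof
    fix N assume N: "N \<in> nbrs l \<inter> nbrs z"
    then have "N \<in> L" "N \<noteq> l" using adj_lines unfolding nbrs_def by blast+
    then have "t \<notin> N" using third by blast
    then show "N \<in> (\<Union>j\<in>z. joining a j \<union> joining b j)"
      using common_nbr_disjoint[OF lL zL disj N] t(1) by (auto simp: joining_def)
  qed
  have fz: "finite z" using finite_line zL .
  have "9 \<le> card (nbrs l \<inter> nbrs z)" by (rule common_ge_9_disjoint[OF z(1,2) disj])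
  also have "\<dots> \<le> card (\<Union>j\<in>z. joining a j \<union> joining b j)" using sub fz by (intro card_mono) auto
  also have "\<dots> \<le> (\<Sum>j\<in>z. card (joining a j \<union> joining b j))" by (rule card_UN_le[OF fz])
  also have "\<dots> \<le> (\<Sum>j\<in>z. card (joining a j) + card (joining b j))" by (intro sum_mono card_Un_le)
  finally have sum: "9 \<le> (\<Sum>j\<in>z. card (joining a j) + card (joining b j))" .
  obtain u v w where uvw: "z = {u, v, w}" "u \<noteq> v" "u \<noteq> w" "v \<noteq> w" using line_cases[OF zL] by metis
  have sum': "9 \<le> (card (joining a u) + card (joining b u)) + ((card (joining a v) + card (joining b v))
     + (card (joining a w) + card (joining b w)))"
    using sum uvw by simp
  have mem: "u \<in> z" "v \<in> z" "w \<in> z" using uvw(1) by auto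
  have "(card (joining a u) = 2 \<and> card (joining b u) = 1 \<and> card (joining a v) = 2 \<and> card (joining b v) = 1
      \<and> card (joining a w) = 2 \<and> card (joining b w) = 1) \<or> 
    (card (joining a u) = 1 \<and> card (joining b u) = 2 \<and> card (joining a v) = 1 \<and> card (joining b v) = 2
      \<and> card (joining a w) = 1 \<and> card (joining b w) = 2)"
    using sum' le[OF mem(1)] le[OF mem(2)] le[OF mem(3)]
      star[OF mem(1,2) uvw(2)] star[OF mem(1,3) uvw(3)] star[OF mem(2,3) uvw(4)]
      star[OF mem(2,1) uvw(2)[symmetric]] star[OF mem(3,1) uvw(3)[symmetric]] star[OF mem(3,2) uvw(4)[symmetric]]
    by (rule two_stars_arith)
  then show ?thesis unfolding uvw(1) by blast
qed

lemma joining_twins_disjoint: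
  assumes "a \<noteq> i" "a \<noteq> j" "i \<noteq> j" "2 \<le> card (joining a i)" "2 \<le> card (joining a j)"
  shows "joining a i \<inter> joining a j = {}"
proof (rule ccontr)
  assume "joining a i \<inter> joining a j \<noteq> {}"
  then obtain w where w: "w \<in> L" "a \<in> w" "i \<in> w" "j \<in> w" by (auto simp: joining_def)
  obtain s where s: "{a, i, s} \<in> L" "{a, i, - s} \<in> L" "joining a i = {{a, i, s}, {a, i, - s}}"
    using joining_twins[OF assms(1,4)] by metis
  have "w \<in> joining a i" using w by (simp add: joining_def)
  then have "j \<in> {a, i, s} \<or> j \<in> {a, i, - s}" using s(3) w(4) by blast
  then have "j = s \<or> j = - s" using assms(2,3) by blast
  then have "joining a j \<subseteq> {{a, i, j}}"
  proof (intro subsetI)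
    fix v assume "v \<in> joining a j"
    then have v: "v \<in> L" "j \<in> v" by (auto simp: joining_def)
    from \<open>j = s \<or> j = - s\<close> show "v \<in> {{a, i, j}}"
    proof
      assume "j = s"
      then show ?thesis using twin_third_unique[OF s(1,2) v(1)] v(2) by simp
    next
      assume js: "j = - s"
      then have "{a, i, - (- s)} \<in> L" "- s \<in> v" using s(1) v(2) by simp_all
      then show ?thesis using twin_third_unique[OF s(2) _ v(1)] js by simp
    qed
  qed
  then have "card (joining a j) \<le> card {{a, i, j}}" by (intro card_mono) auto
  then show False using assms(5) by simp
qed

lemma card_through_twins:
  assumes "finite I" "\<And>i. i \<in> I \<Longrightarrow> a \<noteq> i" "\<And>i. i \<in> I \<Longrightarrow> 2 \<le> card (joining a i)"
  shows "2 * card I \<le> card (through a)"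
proof -
  have "2 * card I = (\<Sum>i\<in>I. 2)" by simp
  also have "\<dots> \<le> (\<Sum>i\<in>I. card (joining a i))" using assms(3) by (rule sum_mono)
  also have "\<dots> = card (\<Union>i\<in>I. joining a i)"
    using assms joining_twins_disjoint by (intro card_UN_disjoint[symmetric]) auto
  also have "\<dots> \<le> card (through a)" by (rule card_mono[OF finite_through]) (auto simp: joining_def through_def)
  finally show ?thesis .
qed

text \<open>
  Assume that \<open>x\<close> has a twin and a disjoint line \<open>z\<close> at distance two, with the twins between \<open>x\<close> and
  \<open>z\<close> all at \<open>a\<close>. Comparing degrees leads to a contradiction. The star at \<open>a\<close> propagates: \<open>a\<close> is joined
  by twins to all points on the lines through \<open>b\<close> and off \<open>a\<close>, so \<open>a\<close> lies on about four times as many lines as \<open>b\<close>.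
  On the other hand the degrees of \<open>x\<close>, of the lines joining \<open>a\<close> to points of \<open>z\<close>, and of \<open>z\<close> allow
  at most twice as many.
\<close>

context
  fixes x z :: "int set" and a b m :: int
  assumes x: "x = {a, b, m}" "x \<in> L" and x': "{a, b, - m} \<in> L"
    and z: "\<exists>M. adj x M \<and> adj M z" and disj: "x \<inter> z = {}"
    and star: "\<And>j. j \<in> z \<Longrightarrow> card (joining a j) = 2" "\<And>j. j \<in> z \<Longrightarrow> card (joining b j) = 1"
begin

lemma z_line: "z \<in> L" using z adj_lines by blast

lemma abm_distinct: "a \<noteq> b" "a \<noteq> m" "b \<noteq> m"
  using distinct_triple card_line[OF x(2)] x(1) by metis+

lemma twin_m: "w \<in> L \<Longrightarrow> m \<in> w \<Longrightarrow> w = x"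
  using twin_third_unique[of a b m w] x x' by simp

lemma twin_m': "w \<in> L \<Longrightarrow> - m \<in> w \<Longrightarrow> w = {a, b, - m}"
  using twin_third_unique[of a b "- m" w] x x' by simp

lemma joining_ab: "card (joining a b) = 2" "x \<in> joining a b" "\<And>w. w \<in> joining a b \<Longrightarrow> w = x \<or> w = {a, b, - m}"
proof -
  show xj: "x \<in> joining a b" using x by (simp add: joining_def)
  have "m \<noteq> - m" using no_opposite[OF x(2), of m] x(1) by auto
  then have "- m \<notin> x" using no_opposite[OF x(2), of m] x(1) by auto
  then have ne: "x \<noteq> {a, b, - m}" by blast
  have "{x, {a, b, - m}} \<subseteq> joining a b" using xj x' by (simp add: joining_def)
  then have "card {x, {a, b, - m}} \<le> card (joining a b)" by (intro card_mono) auto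
  moreover have "card {x, {a, b, - m}} = 2" using ne by simp
  ultimately show c: "card (joining a b) = 2" using card_joining[OF abm_distinct(1)] by linarith
  have "{x, {a, b, - m}} = joining a b"
    using \<open>{x, {a, b, - m}} \<subseteq> joining a b\<close> c ne by (intro card_seteq) auto
  then show "w = x \<or> w = {a, b, - m}" if "w \<in> joining a b" for w using that by blast
qed

lemma z_off_x: "j \<in> z \<Longrightarrow> j \<notin> x" "j \<in> z \<Longrightarrow> - j \<notin> x" "e \<in> x \<Longrightarrow> - e \<notin> z"
  using disj disjoint_opposite[OF z_line x(2)] disjoint_opposite[OF x(2) z_line disj] by blast+

lemma z_off_ab: "j \<in> z \<Longrightarrow> j \<noteq> a \<and> j \<noteq> b \<and> j \<noteq> - a \<and> j \<noteq> - b"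
  using z_off_x[of j] x(1) by auto

lemma a_unopposed: "w \<in> L \<Longrightarrow> - a \<notin> w"
proof
  assume w: "w \<in> L" "- a \<in> w"
  have "b \<notin> z" "finite z" using z_off_ab finite_line[OF z_line] by auto
  then have "2 * card (insert b z) \<le> card (through a)"
    using z_off_ab abm_distinct(1) star(1) joining_ab(1) by (intro card_through_twins) auto
  moreover have "card (insert b z) = 4" using \<open>b \<notin> z\<close> \<open>finite z\<close> card_line[OF z_line] by simp
  ultimately show False using card_through_opposite[OF w] by simp
qed

text \<open>
  Choose a point \<open>j\<close> of \<open>z\<close> off \<open>w\<close>. The line \<open>w\<close> is at distance two from a line joining \<open>a\<close> to \<open>j\<close>,
  through \<open>x\<close>. That line has a twin, so \<open>twin_star\<close> applies to it and \<open>w\<close>; the star is at \<open>a\<close> as \<open>b\<close> and \<open>j\<close> are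
  joined only once.
\<close>

lemma other_through_b:
  assumes w: "w \<in> L" "b \<in> w" "a \<notin> w" and i: "i \<in> w" "i \<noteq> b"
  shows "card (joining a i) = 2" "card (joining b i) \<le> 1"
proof -
  have mw: "m \<notin> w" "- m \<notin> w" using twin_m[OF w(1)] twin_m'[OF w(1)] w(3) x(1) by auto
  have bz: "b \<notin> z" using z_off_ab by blast
  have "\<not> z \<subseteq> w"
  proof
    assume "z \<subseteq> w"
    then have "z = w" using card_line[OF z_line] card_line[OF w(1)] finite_line[OF w(1)]
      by (intro card_seteq) auto
    then show False using bz w(2) by simp
  qed
  then obtain j where j: "j \<in> z" "j \<notin> w" by blast
  have aj: "a \<noteq> j" using z_off_ab[OF j(1)] by simp
  obtain f where f: "{a, j, f} \<in> L" "{a, j, - f} \<in> L" using joining_twins[OF aj] star(1)[OF j(1)] by auto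
  have jx: "j \<notin> x" "- j \<notin> x" using z_off_x j by auto
  have "- f \<notin> x"
  proof
    assume "- f \<in> x"
    then have "x = {a, j, - f}" using twin_third_unique[of a j "- f" x] f x by simp
    then show False using jx by blast
  qed
  moreover have "{a, j, f} \<noteq> x" "a \<in> x" using jx x(1) by auto
  ultimately have 1: "adj {a, j, f} x" using jx by (intro adj_tripleI[OF refl f(1) x(2)])
  have xb: "x = {b, a, m}" using x(1) by auto
  have "x \<noteq> w" using w(3) x(1) by auto
  then have 2: "adj x w" using w mw a_unopposed by (intro adj_tripleI[OF xb x(2) w(1)])
  have "(\<forall>i\<in>w. card (joining a i) = 2 \<and> card (joining j i) = 1) \<or>
    (\<forall>i\<in>w. card (joining a i) = 1 \<and> card (joining j i) = 2)"
  proof (rule twin_star[OF aj _ _ 1 2 w(3) j(2)])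
    show "2 \<le> card (joining a j)" using star(1)[OF j(1)] by simp
    show "{a, j, f} \<in> joining a j" using f by (simp add: joining_def)
  qed
  moreover have "card (joining j b) = 1" using star(2)[OF j(1)] by (simp add: joining_commute)
  ultimately show "card (joining a i) = 2" using w(2) i(1) by force
  show "card (joining b i) \<le> 1"
  proof (rule ccontr)
    assume gt: "\<not> card (joining b i) \<le> 1"
    have "\<not> z \<subseteq> {i}" using card_line[OF z_line] card_mono[of "{i}" z] by auto
    then obtain j' where j': "j' \<in> z" "j' \<noteq> i" by blast
    have "i \<noteq> - b" using no_opposite[OF w(1,2)] i by auto
    moreover have "i \<noteq> - a" using a_unopposed[OF w(1)] i by auto
    moreover have "i \<noteq> - m" "i \<noteq> m" using mw i by auto
    ultimately have "i \<notin> x" "- i \<notin> x" using x(1) i w(3) by auto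
    moreover have "a \<in> x" "b \<in> x" using x(1) by auto
    ultimately show False
      using no_disjoint_twins[of a j' b i x] star(1)[OF j'(1)] gt x(2) abm_distinct(1) z_off_x(1,2)[OF j'(1)] j'(2)
      by simp
  qed
qed

lemma card_through_b_ge: "5 \<le> card (through b)"
proof -
  have one: "\<exists>w. w \<in> joining b j" if "j \<in> z" for j
    using star(2)[OF that] by (metis card.empty ex_in_conv zero_neq_one)
  have fz: "finite z" using finite_line[OF z_line] .
  have ab: "joining a b \<inter> (\<Union>j\<in>z. joining b j) = {}"
  proof (rule ccontr)
    assume "joining a b \<inter> (\<Union>j\<in>z. joining b j) \<noteq> {}"
    then obtain w j where w: "w \<in> joining a b" "w \<in> joining b j" "j \<in> z" by blast
    then have "j \<in> x \<or> j \<in> {a, b, - m}" using joining_ab(3)[OF w(1)] by (auto simp: joining_def)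
    then have "j \<in> x \<or> j = - m" using x(1) by blast
    then show False using z_off_x(1)[OF w(3)] z_off_x(3)[of m] w(3) x(1) by blast
  qed
  have disjoint: "joining b i \<inter> joining b j = {}" if ij: "i \<in> z" "j \<in> z" "i \<noteq> j" for i j
  proof (rule ccontr)
    assume "joining b i \<inter> joining b j \<noteq> {}"
    then obtain w where w: "w \<in> L" "b \<in> w" "i \<in> w" "j \<in> w" by (auto simp: joining_def)
    have "w \<noteq> z" using w(2) z_off_ab by blast
    then obtain s where s: "w = {i, j, s}" "z = {i, j, - s}"
      using two_common[OF w(1) z_line _ ij(3) w(3,4) ij(1,2)] by metis
    have "b \<in> {i, j, s}" using w(2) s(1) by blast
    then have "b = s" using z_off_ab[OF ij(1)] z_off_ab[OF ij(2)] by blast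
    then have "- b \<in> z" using s(2) by blast
    then show False using z_off_x(3)[of b] x(1) by blast
  qed
  have "card (\<Union>j\<in>z. joining b j) = (\<Sum>j\<in>z. card (joining b j))"
    using fz disjoint by (intro card_UN_disjoint) auto
  also have "\<dots> = (\<Sum>j\<in>z. 1)" using star(2) by (intro sum.cong) auto
  also have "\<dots> = 3" using card_line[OF z_line] by simp
  finally have "card (joining a b \<union> (\<Union>j\<in>z. joining b j)) = 5"
    using ab joining_ab(1) fz by (subst card_Un_disjoint) auto
  moreover have "card (joining a b \<union> (\<Union>j\<in>z. joining b j)) \<le> card (through b)"
    by (rule card_mono[OF finite_through]) (auto simp: joining_def through_def)
  ultimately show ?thesis by simp
qed

lemma card_through_a_ge: "4 * card (through b) \<le> card (through a) + 6"
proof -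
  \<comment> \<open>\<open>I\<close> is the set of points collinear with \<open>b\<close> on lines off \<open>a\<close>. It is partitioned by the lines
    in \<open>W\<close>, and each of its points is joined to \<open>a\<close> by twins, as is \<open>b\<close>.\<close>
  define W where "W = through b - joining a b"
  define I where "I = (\<Union>w\<in>W. w - {b})"
  have W: "w \<in> L" "b \<in> w" "a \<notin> w" if "w \<in> W" for w
    using that by (auto simp: W_def joining_def through_def)
  have finW: "finite W" by (simp add: W_def)
  have "joining a b \<subseteq> through b" by (auto simp: joining_def through_def)
  then have cW: "card W = card (through b) - 2"
    unfolding W_def using joining_ab(1) by (simp add: card_Diff_subset)
  have c2: "card (w - {b}) = 2" if "w \<in> W" for w using card_line[OF W(1)[OF that]] W(2)[OF that] by simp
  have "(w - {b}) \<inter> (w' - {b}) = {}" if "w \<in> W" "w' \<in> W" "w \<noteq> w'" for w w'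
  proof (rule ccontr)
    assume "(w - {b}) \<inter> (w' - {b}) \<noteq> {}"
    then obtain i where i: "i \<in> w" "i \<in> w'" "i \<noteq> b" by blast
    have "{w, w'} \<subseteq> joining b i" using W that i by (auto simp: joining_def)
    then have "card {w, w'} \<le> card (joining b i)" by (intro card_mono) auto
    then show False using other_through_b(2)[OF W[OF that(1)] i(1,3)] that(3) by simp
  qed
  moreover have "\<forall>w\<in>W. finite (w - {b})" using W finite_line by blast
  ultimately have "card I = (\<Sum>w\<in>W. card (w - {b}))"
    unfolding I_def using finW by (intro card_UN_disjoint) auto
  also have "\<dots> = 2 * card W" using c2 by simp
  finally have cI: "card I = 2 * card W" .
  have finI: "finite I" unfolding I_def using finW W finite_line by blast
  have "i \<noteq> a \<and> card (joining a i) = 2" if "i \<in> I" for i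
    using that other_through_b(1) W unfolding I_def by blast
  then have "2 * card (insert b I) \<le> card (through a)"
    using finI joining_ab(1) abm_distinct(1) by (intro card_through_twins) auto
  moreover have "card (insert b I) = card I + 1"
    using finI card_insert_disjoint[of I b] unfolding I_def by simp
  ultimately show ?thesis using cI cW card_through_b_ge by linarith
qed

lemma k_le_through_ab: "k + 3 \<le> card (through a) + card (through b)"
proof -
  have "nbrs x \<subseteq> (through a \<union> through b) - {x}"
  proof
    fix w assume "w \<in> nbrs x"
    then have w: "adj x w" by (simp add: nbrs_def)
    then have wL: "w \<in> L" "x \<noteq> w" using adj_lines by auto
    obtain e where e: "e \<in> x" "e \<in> w" using adj_common[OF w] .
    have "e \<noteq> m" using twin_m[OF wL(1)] e wL(2) by blast
    then show "w \<in> (through a \<union> through b) - {x}" using e x(1) wL by (auto simp: through_def)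
  qed
  then have "k \<le> card ((through a \<union> through b) - {x})"
    using regular[OF x(2)] card_mono[of "(through a \<union> through b) - {x}" "nbrs x"] by simp
  also have "\<dots> = card (through a \<union> through b) - 1" using x by (simp add: through_def)
  finally have "k \<le> card (through a \<union> through b) - 1" .
  moreover have "through a \<inter> through b = joining a b" by (auto simp: joining_def through_def)
  then have "card (through a) + card (through b) = card (through a \<union> through b) + 2"
    using card_Un_Int[of "through a" "through b"] joining_ab(1) by simp
  ultimately show ?thesis using card_through_b_ge k_ge by linarith
qed

text \<open>
  Every line through \<open>a\<close> or \<open>j\<close> is adjacent to a line joining \<open>a\<close> to \<open>j\<close>. The only obstruction would be
  a line through \<open>a\<close> and \<open>- j\<close>; it shares a point \<open>h\<close> with \<open>z\<close>, so it is one of the twins joining \<open>a\<close>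
  to \<open>h\<close>, and then \<open>j\<close> lies on no line but these.
\<close>

lemma k_ge_through_aj:
  assumes j: "j \<in> z"
  shows "card (through a) + card (through j) \<le> k + 3"
proof -
  have aj: "a \<noteq> j" using z_off_ab[OF j] by simp
  obtain f where f: "{a, j, f} \<in> L" "{a, j, - f} \<in> L" using joining_twins[OF aj] star(1)[OF j] by auto
  have F: "w = {a, j, - f}" if "w \<in> L" "- f \<in> w" for w
    using twin_third_unique[of a j "- f" w] f that by simp
  have "(through a \<union> through j) - {{a, j, f}} \<subseteq> nbrs {a, j, f}"
  proof
    fix w assume w: "w \<in> (through a \<union> through j) - {{a, j, f}}"
    then have wL: "w \<in> L" "{a, j, f} \<noteq> w" by (auto simp: through_def)
    have "adj {a, j, f} w"
    proof (cases "- f \<in> w")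
      case True
      then have "w = {a, j, - f}" using F wL by blast
      then show ?thesis by (intro adjI2[OF f(1) wL aj]) auto
    next
      case nf: False
      show ?thesis
      proof (cases "a \<in> w")
        case True
        have "- j \<notin> w"
        proof
          assume nj: "- j \<in> w"
          obtain h where h: "h \<in> z" "h \<in> w" using opposite_imp_common[OF z_line wL(1) j nj] .
          have "- h \<noteq> j" using no_opposite[OF z_line h(1)] j by blast
          then have hj: "- j \<noteq> h" by auto
          have ah: "a \<noteq> h" using z_off_ab[OF h(1)] by simp
          obtain r where r: "{a, h, r} \<in> L" "{a, h, - r} \<in> L" "joining a h = {{a, h, r}, {a, h, - r}}"
            using joining_twins[OF ah] star(1)[OF h(1)] by auto
          have "w \<in> joining a h" using True h wL by (simp add: joining_def)
          then have "- j \<in> {a, h, r} \<or> - j \<in> {a, h, - r}" using nj r(3) by blast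
          moreover have "- j \<noteq> a" using z_off_ab[OF j] by auto
          ultimately have "- j = r \<or> j = r" using hj by auto
          then have "{a, h, j} \<in> L" "{a, h, - j} \<in> L" using r(1,2) by auto
          then have "z = {a, h, j}" using twin_third_unique[of a h j z] z_line j by simp
          then show False using z_off_ab by blast
        qed
        then show ?thesis using True nf by (intro adj_tripleI[OF refl f(1) wL])
      next
        case False
        then have "j \<in> w" using w by (auto simp: through_def)
        moreover have "{a, j, f} = {j, a, f}" by auto
        ultimately show ?thesis using nf a_unopposed[OF wL(1)] by (intro adj_tripleI[OF _ f(1) wL])
      qed
    qed
    then show "w \<in> nbrs {a, j, f}" by (simp add: nbrs_def)
  qed
  then have "card ((through a \<union> through j) - {{a, j, f}}) \<le> k"
    using regular[OF f(1)] card_mono[OF finite_nbrs, of _ "{a, j, f}"] by metis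
  moreover have "card ((through a \<union> through j) - {{a, j, f}}) = card (through a \<union> through j) - 1"
    using f by (simp add: through_def)
  moreover have "through a \<inter> through j = joining a j" by (auto simp: joining_def through_def)
  then have "card (through a) + card (through j) = card (through a \<union> through j) + 2"
    using card_Un_Int[of "through a" "through j"] star(1)[OF j] by simp
  ultimately show ?thesis by linarith
qed

lemma k_le_through_z: "k + 3 \<le> (\<Sum>j\<in>z. card (through j))"
proof -
  have fz: "finite z" using finite_line[OF z_line] .
  have "nbrs z \<subseteq> (\<Union>j\<in>z. through j - {z})"
  proof
    fix w assume "w \<in> nbrs z"
    then have w: "adj z w" by (simp add: nbrs_def)
    then show "w \<in> (\<Union>j\<in>z. through j - {z})"
      using adj_lines[OF w] adj_common[OF w] by (auto simp: through_def)
  qed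
  then have "card (nbrs z) \<le> card (\<Union>j\<in>z. through j - {z})" using fz by (intro card_mono) auto
  also have "\<dots> \<le> (\<Sum>j\<in>z. card (through j - {z}))" by (rule card_UN_le[OF fz])
  finally have "k + (\<Sum>j\<in>z. 1) \<le> (\<Sum>j\<in>z. card (through j - {z})) + (\<Sum>j\<in>z. 1)" using regular[OF z_line] by simp
  also have "\<dots> = (\<Sum>j\<in>z. card (through j - {z}) + 1)" by (rule sum.distrib[symmetric])
  also have "\<dots> = (\<Sum>j\<in>z. card (through j))"
  proof (rule sum.cong[OF refl])
    fix j assume "j \<in> z"
    then have "z \<in> through j" using z_line by (simp add: through_def)
    then show "card (through j - {z}) + 1 = card (through j)"
      using card_Suc_Diff1[of "through j" z] by simp
  qed
  finally show ?thesis using card_line[OF z_line] by simp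
qed

lemma twin_star_impossible: False
proof -
  have "(\<Sum>j\<in>z. card (through a) + card (through j)) \<le> (\<Sum>j\<in>z. k + 3)" using k_ge_through_aj by (rule sum_mono)
  then have "3 * card (through a) + (\<Sum>j\<in>z. card (through j)) \<le> 3 * (k + 3)"
    using card_line[OF z_line] by (simp add: sum.distrib)
  then have "3 * card (through a) \<le> 2 * k + 6" using k_le_through_z by simp
  then show False using k_le_through_ab card_through_a_ge card_through_b_ge by linarith
qed

end

lemma card_joining_le_1:
  assumes "a \<noteq> b" shows "card (joining a b) \<le> 1"
proof (rule ccontr)
  assume "\<not> card (joining a b) \<le> 1"
  then have two: "2 \<le> card (joining a b)" by simp
  obtain m where m: "{a, b, m} \<in> L" "{a, b, - m} \<in> L" using joining_twins[OF assms two] by metis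
  obtain z M where z: "adj {a, b, m} M" "adj M z" "{a, b, m} \<inter> z = {}"
    using ex_disjoint_at_distance_two[OF m(1)] .
  have j: "{a, b, m} \<in> joining a b" using m by (simp add: joining_def)
  have "(\<forall>j\<in>z. card (joining a j) = 2 \<and> card (joining b j) = 1) \<or>
    (\<forall>j\<in>z. card (joining a j) = 1 \<and> card (joining b j) = 2)"
    using z(3) by (intro twin_star[OF assms two j z(1,2)]) auto
  then show False
  proof
    assume s: "\<forall>j\<in>z. card (joining a j) = 2 \<and> card (joining b j) = 1"
    show False by (rule twin_star_impossible[OF refl m _ z(3)]) (use z s in auto)
  next
    assume s: "\<forall>j\<in>z. card (joining a j) = 1 \<and> card (joining b j) = 2"
    have "{a, b, m} = {b, a, m}" "{b, a, - m} \<in> L" using m by (auto simp: insert_commute)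
    then show False by (rule twin_star_impossible[OF _ m(1) _ _ z(3)]) (use z s in auto)
  qed
qed

section \<open>The lines form a Steiner triple system\<close>

lemma joining_unique:
  "l \<in> L \<Longrightarrow> m \<in> L \<Longrightarrow> a \<noteq> b \<Longrightarrow> a \<in> l \<Longrightarrow> b \<in> l \<Longrightarrow> a \<in> m \<Longrightarrow> b \<in> m \<Longrightarrow> l = m"
  using card_joining_le_1[of a b] card_le_Suc0_iff_eq[OF finite_joining, of a b]
  unfolding joining_def by simp

text \<open>
  If \<open>p\<close> has an opposite point, it is on at most two lines. A disjoint line at distance two from
  \<open>l\<close> then has at most one common neighbour with \<open>l\<close> through \<open>p\<close> and at most six others.
\<close>

lemma unopposed:
  assumes l: "l \<in> L" "p \<in> l" and m: "m \<in> L"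
  shows "- p \<notin> m"
proof
  assume mp: "- p \<in> m"
  obtain q t where qt: "l = {p, q, t}" "p \<noteq> q" "p \<noteq> t" "q \<noteq> t" using line_cases_point[OF l] by metis
  obtain z M where z: "adj l M" "adj M z" "l \<inter> z = {}" using ex_disjoint_at_distance_two[OF l(1)] .
  have zL: "z \<in> L" using z adj_lines by blast
  obtain a b where ab: "m = {- p, a, b}" using line_cases_point[OF m mp] by metis
  have p: "p \<noteq> a" "p \<noteq> b" using no_opposite[OF m mp] ab by auto
  have "through p \<subseteq> joining p a \<union> joining p b"
  proof
    fix w assume "w \<in> through p"
    then have w: "w \<in> L" "p \<in> w" by (auto simp: through_def)
    obtain e where "e \<in> w" "e \<in> m" using opposite_imp_common[OF w(1) m w(2) mp] .
    then show "w \<in> joining p a \<union> joining p b" using ab w no_opposite[OF w] by (auto simp: joining_def)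
  qed
  then have "card (through p) \<le> card (joining p a \<union> joining p b)" by (intro card_mono) auto
  also have "\<dots> \<le> card (joining p a) + card (joining p b)" by (rule card_Un_le)
  also have "\<dots> \<le> 2" using card_joining_le_1[OF p(1)] card_joining_le_1[OF p(2)] by linarith
  finally have tp: "card (through p) \<le> 2" .
  have fz: "finite z" using finite_line[OF zL] .
  have "nbrs l \<inter> nbrs z \<subseteq> through p \<union> (\<Union>j\<in>z. joining q j \<union> joining t j)"
  proof
    fix N assume N: "N \<in> nbrs l \<inter> nbrs z"
    show "N \<in> through p \<union> (\<Union>j\<in>z. joining q j \<union> joining t j)"
      using common_nbr_disjoint[OF l(1) zL z(3) N] qt(1) by (auto simp: joining_def through_def)
  qed
  then have "card (nbrs l \<inter> nbrs z) \<le> card (through p \<union> (\<Union>j\<in>z. joining q j \<union> joining t j))"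
    using fz by (intro card_mono) auto
  also have "\<dots> \<le> card (through p) + card (\<Union>j\<in>z. joining q j \<union> joining t j)" by (rule card_Un_le)
  also have "card (\<Union>j\<in>z. joining q j \<union> joining t j) \<le> (\<Sum>j\<in>z. card (joining q j \<union> joining t j))"
    by (rule card_UN_le[OF fz])
  also have "\<dots> \<le> (\<Sum>j\<in>z. 2)"
  proof (rule sum_mono)
    fix j assume "j \<in> z"
    then have "q \<noteq> j" "t \<noteq> j" using z(3) qt(1) by auto
    then show "card (joining q j \<union> joining t j) \<le> 2"
      using card_joining_le_1[of q j] card_joining_le_1[of t j] card_Un_le[of "joining q j" "joining t j"] by linarith
  qed
  finally show False using tp card_line[OF zL] common_ge_9_disjoint[OF z] by simp
qed

lemma adj_iff: "adj l m \<longleftrightarrow> l \<in> L \<and> m \<in> L \<and> l \<noteq> m \<and> l \<inter> m \<noteq> {}"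
proof
  assume "l \<in> L \<and> m \<in> L \<and> l \<noteq> m \<and> l \<inter> m \<noteq> {}"
  then show "adj l m" using adjI[of l m] unopposed by blast
qed (auto simp: adj_lines elim: adj_common)

text \<open>
  Nine pairs of points, each joined at most once, account for at least nine common neighbours.
\<close>

lemma disjoint_fully_joined:
  assumes "adj l M" "adj M z" "l \<inter> z = {}"
  shows "c = 9" and "i \<in> l \<Longrightarrow> j \<in> z \<Longrightarrow> joining i j \<noteq> {}"
proof -
  have L: "l \<in> L" "z \<in> L" using assms adj_lines by auto
  define P where "P = {(i, j) \<in> l \<times> z. joining i j \<noteq> {}}"
  have fin: "finite (l \<times> z)" using finite_line L by blast
  have P: "P \<subseteq> l \<times> z" by (auto simp: P_def)
  then have fP: "finite P" using fin finite_subset by blast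
  have "nbrs l \<inter> nbrs z \<subseteq> (\<Union>(i, j)\<in>P. joining i j)"
  proof
    fix N assume N: "N \<in> nbrs l \<inter> nbrs z"
    show "N \<in> (\<Union>(i, j)\<in>P. joining i j)"
      by (rule common_nbr_disjoint[OF L assms(3) N]) (auto simp: P_def)
  qed
  then have "card (nbrs l \<inter> nbrs z) \<le> card (\<Union>(i, j)\<in>P. joining i j)"
    using fP by (intro card_mono) auto
  also have "\<dots> \<le> (\<Sum>(i, j)\<in>P. card (joining i j))"
    using card_UN_le[OF fP, of "\<lambda>(i, j). joining i j"] by (simp add: case_prod_unfold)
  also have "\<dots> \<le> (\<Sum>(i, j)\<in>P. 1)"
  proof (rule sum_mono)
    fix q assume "q \<in> P"
    then obtain i j where q: "q = (i, j)" "i \<in> l" "j \<in> z" using P by blast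
    then have "i \<noteq> j" using assms(3) by blast
    then show "(case q of (i, j) \<Rightarrow> card (joining i j)) \<le> (case q of (i, j) \<Rightarrow> 1)"
      using card_joining_le_1 q(1) by simp
  qed
  also have "\<dots> = card P" by simp
  finally have le: "card (nbrs l \<inter> nbrs z) \<le> card P" .
  have c9: "card (l \<times> z) = 9" using card_line L by (simp add: card_cartesian_product)
  have PP: "card P \<le> card (l \<times> z)" using P fin by (rule card_mono[rotated])
  have "l \<noteq> z" "\<not> adj l z" using adj_common[OF assms(1)] assms(3) disjoint_not_adj by blast+
  then show "c = 9" using sesqui[OF assms(1,2)] le PP c9 c_ge by simp
  have "card (l \<times> z) \<le> card P" using le c9 common_ge_9_disjoint[OF assms] by simp
  then have "P = l \<times> z" using P fin by (intro card_seteq) auto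
  then show "i \<in> l \<Longrightarrow> j \<in> z \<Longrightarrow> joining i j \<noteq> {}" by (auto simp: P_def)
qed

text \<open>
  If \<open>z\<close> is at distance two from \<open>l\<close> and \<open>w\<close> meets \<open>z\<close> in \<open>p\<close>, then a line joining \<open>p\<close> to a point of \<open>l\<close>
  shows that \<open>w\<close> is at distance at most two from \<open>l\<close>.
\<close>

lemma disjoint_common_nbr:
  assumes "l \<in> L" "m \<in> L" "l \<inter> m = {}"
  obtains M where "adj l M" "adj M m"
proof -
  have "w = l \<or> adj l w \<or> (\<exists>M. adj l M \<and> adj M w)" if "adj\<^sup>*\<^sup>* l w" for w
    using that
  proof induction
    case (step z w)
    show ?case
    proof (cases "l \<inter> z = {} \<and> l \<inter> w = {}")
      case True
      have "z \<noteq> {}" using card_line[OF adj_lines(1)[OF step.hyps(2)]] by auto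
      then have "z \<noteq> l" "\<not> adj l z" using True adj_iff by blast+
      then obtain M where M: "adj l M" "adj M z" using step.IH by blast
      obtain p where p: "p \<in> z" "p \<in> w" using adj_common[OF step.hyps(2)] .
      obtain i where i: "i \<in> l" using adj_common[OF M(1)] by blast
      obtain N where N: "N \<in> L" "i \<in> N" "p \<in> N"
        using disjoint_fully_joined(2)[OF M _ i p(1)] True by (auto simp: joining_def)
      have "N \<noteq> w" "N \<noteq> l" using N i p True by auto
      moreover have "w \<in> L" using step.hyps adj_lines by blast
      ultimately have "adj l N" "adj N w" using N i p assms(1) by (auto simp: adj_iff)
      then show ?thesis by blast
    next
      case False
      then show ?thesis
      proof (cases "l \<inter> w = {}")
        case True
        then have "l \<inter> z \<noteq> {}" using False by simp
        then have "l = z \<or> adj l z"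
          using adj_iff[of l z] assms(1) adj_lines(1)[OF step.hyps(2)] by blast
        then show ?thesis using step.hyps(2) by blast
      next
        case False
        then show ?thesis using adj_iff[of l w] assms(1) adj_lines(2)[OF step.hyps(2)] by blast
      qed
    qed
  qed simp
  then have "m = l \<or> adj l m \<or> (\<exists>M. adj l M \<and> adj M m)" using connected assms by blast
  moreover have "m \<noteq> l" using assms card_line by fastforce
  ultimately show ?thesis using that assms(3) adj_iff by blast
qed

lemma card_through_ge_4:
  assumes "l \<in> L" "i \<in> l" shows "4 \<le> card (through i)"
proof -
  obtain z M where z: "adj l M" "adj M z" "l \<inter> z = {}" using ex_disjoint_at_distance_two[OF assms(1)] .
  have zL: "z \<in> L" using z adj_lines by blast
  have iz: "i \<notin> z" using assms z by blast
  have fz: "finite z" using finite_line[OF zL] .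
  have "joining i j \<noteq> {}" if "j \<in> z" for j using disjoint_fully_joined(2)[OF z assms(2) that] .
  then have "\<forall>j\<in>z. \<exists>w. w \<in> joining i j" by blast
  then obtain w where w: "\<And>j. j \<in> z \<Longrightarrow> w j \<in> joining i j" by metis
  have "inj_on w z"
  proof (rule inj_onI, rule ccontr)
    fix j j' assume j: "j \<in> z" "j' \<in> z" "w j = w j'" "j \<noteq> j'"
    then have "w j = z" using w[OF j(1)] w[OF j(2)] zL by (intro joining_unique[of _ _ j j']) (auto simp: joining_def)
    then show False using w[OF j(1)] iz by (simp add: joining_def)
  qed
  then have "card (w ` z) = 3" using card_image card_line[OF zL] by metis
  moreover have "l \<notin> w ` z" using w z(3) by (auto simp: joining_def)
  ultimately have "card (insert l (w ` z)) = 4" using fz by simp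
  moreover have "card (insert l (w ` z)) \<le> card (through i)"
    by (rule card_mono[OF finite_through]) (use w assms in \<open>auto simp: joining_def through_def\<close>)
  ultimately show ?thesis by simp
qed

text \<open>
  Let \<open>l\<close> be a line through \<open>i\<close>. If \<open>j\<close> is not joined to \<open>i\<close>, at most two lines through \<open>j\<close> meet \<open>l\<close>,
  namely in the other two points of \<open>l\<close>. As \<open>j\<close> is on at least four lines, one of these is disjoint
  from \<open>l\<close>, and its points are joined to \<open>i\<close> after all.
\<close>

lemma ex1_line:
  assumes "i \<in> \<Union>L" "j \<in> \<Union>L" "i \<noteq> j"
  shows "\<exists>!l. l \<in> L \<and> {i, j} \<subseteq> l"
proof -
  have "\<exists>l\<in>L. i \<in> l \<and> j \<in> l"
  proof (rule ccontr)
    assume no: "\<not> ?thesis"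
    obtain l m where l: "l \<in> L" "i \<in> l" and m: "m \<in> L" "j \<in> m" using assms by blast
    have jl: "j \<notin> l" using no l by blast
    have "finite (l - {i})" "card (l - {i}) = 2" using l card_line[OF l(1)] finite_line[OF l(1)] by auto
    then have "card (\<Union>e\<in>l - {i}. joining j e) \<le> (\<Sum>e\<in>l - {i}. card (joining j e))" by (intro card_UN_le)
    also have "\<dots> \<le> (\<Sum>e\<in>l - {i}. 1)" using jl by (intro sum_mono card_joining_le_1) auto
    finally have "card (\<Union>e\<in>l - {i}. joining j e) < card (through j)"
      using card_through_ge_4[OF m] \<open>card (l - {i}) = 2\<close> by simp
    then obtain w where "w \<in> through j" "w \<notin> (\<Union>e\<in>l - {i}. joining j e)"
      using ex_not_in_smaller[of "\<Union>e\<in>l - {i}. joining j e" "through j"] \<open>finite (l - {i})\<close> by auto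
    then have w: "w \<in> L" "j \<in> w" "l \<inter> w = {}" using no by (auto simp: joining_def through_def)
    obtain M where M: "adj l M" "adj M w" using disjoint_common_nbr[OF l(1) w(1,3)] .
    show False using disjoint_fully_joined(2)[OF M w(3) l(2) w(2)] no by (auto simp: joining_def)
  qed
  then show ?thesis using joining_unique[OF _ _ assms(3)] by (auto simp: Ex1_def)
qed

lemma c_eq_9: "c = 9"
proof -
  obtain l where "l \<in> L" using not_complete by blast
  then show ?thesis using ex_disjoint_at_distance_two[of l] disjoint_fully_joined(1) by metis
qed

lemma adj_iff_card: "l \<in> L \<Longrightarrow> m \<in> L \<Longrightarrow> adj l m \<longleftrightarrow> card (l \<inter> m) = 1"
proof -
  assume L: "l \<in> L" "m \<in> L"
  have "l \<inter> uminus ` m = {}" using unopposed L uminus_image_iff by blast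
  moreover have "card (l \<inter> m) \<noteq> 1" if "l = m" using that card_line L by simp
  ultimately show ?thesis using L by (auto simp: adj_def)
qed

lemma steiner_triple_system_lines:
  assumes g: "inj g"
  shows "steiner_triple_system (card (g ` \<Union>L)) (g ` \<Union>L) ((`) g ` L)"
  unfolding steiner_triple_system_def
proof (intro conjI ballI allI impI)
  show "finite (g ` \<Union>L)" using finite_lines finite_line by auto
  show "card (g ` \<Union>L) = card (g ` \<Union>L)" ..
next
  fix b assume "b \<in> (`) g ` L"
  then obtain l where l: "l \<in> L" "b = g ` l" by blast
  show "b \<subseteq> g ` \<Union>L" using l by auto
  show "card b = 3" using l card_line card_image inj_on_subset[OF g] by (metis subset_UNIV)
next
  fix e assume e: "e \<subseteq> g ` \<Union>L \<and> card e = 2"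
  then obtain i j where ij: "e = {g i, g j}" "i \<in> \<Union>L" "j \<in> \<Union>L" "g i \<noteq> g j"
    by (auto simp: card_2_iff image_iff) metis
  then obtain l where l: "l \<in> L" "{i, j} \<subseteq> l" "\<And>m. m \<in> L \<Longrightarrow> {i, j} \<subseteq> m \<Longrightarrow> m = l"
    using ex1_line[of i j] by blast
  have sub: "e \<subseteq> g ` m \<longleftrightarrow> {i, j} \<subseteq> m" for m using ij(1) g by (auto simp: inj_image_mem_iff)
  show "\<exists>!b. b \<in> (`) g ` L \<and> e \<subseteq> b"
  proof (rule ex1I[of _ "g ` l"])
    show "g ` l \<in> (`) g ` L \<and> e \<subseteq> g ` l" using l(1,2) sub by blast
    show "b = g ` l" if b: "b \<in> (`) g ` L \<and> e \<subseteq> b" for b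
    proof -
      obtain m where m: "m \<in> L" "b = g ` m" using b by blast
      then have "{i, j} \<subseteq> m" using b sub by blast
      then show ?thesis using l(3) m by simp
    qed
  qed
qed

end

section \<open>Distance, degree and eigenvalues\<close>

lemma distance_eq_2:
  assumes G: "pair_graph G" and "x \<noteq> y" "(x, y) \<notin> parcs G" "(x, z) \<in> parcs G" "(z, y) \<in> parcs G"
  shows "distance G x y = 2"
proof -
  interpret pair_graph G by (rule G)
  have V: "x \<in> pverts G" "y \<in> pverts G" using assms(4,5) in_arcsD1 in_arcsD2 by blast+
  have cost: "awalk_cost (\<lambda>_. 1) p = real (length p)" for p :: "('a \<times> 'a) list"
    by (induction p) auto
  have "awalk x [(x, z), (z, y)] y"
    using assms V by (simp add: awalk_Cons_iff awalk_Nil_iff)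
  then have le: "\<mu> (\<lambda>_. 1) x y \<le> 2"
    using min_cost_le_walk_cost[of x "[(x, z), (z, y)]" y "\<lambda>_. 1"] by simp
  have "2 \<le> ereal (awalk_cost (\<lambda>_. 1) p)" if p: "awalk x p y" for p
  proof -
    have "p \<noteq> []" using p assms(2) by (auto simp: awalk_Nil_iff)
    moreover have "p \<noteq> [e]" for e using p assms(3) by (auto simp: awalk_Cons_iff awalk_Nil_iff)
    ultimately have "2 \<le> length p" by (cases p rule: remdups_adj.cases) auto
    then show ?thesis by (simp add: cost)
  qed
  then have "2 \<le> \<mu> (\<lambda>_. 1) x y" unfolding \<mu>_def by (auto intro: INF_greatest)
  with le show ?thesis unfolding distance_def by simp
qed

lemma parcs_sym: "pair_graph G \<Longrightarrow> (x, y) \<in> parcs G \<Longrightarrow> (y, x) \<in> parcs G"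
proof -
  assume "pair_graph G" and xy: "(x, y) \<in> parcs G"
  then interpret pair_graph G by simp
  show "(y, x) \<in> parcs G" using pair_sym_arcs xy by (auto simp: symmetric_def dest: symD)
qed

lemma connected_imp_rtranclp:
  assumes G: "pair_graph G" and "connected (with_proj G)" and V: "x \<in> pverts G" "y \<in> pverts G"
  shows "(\<lambda>u v. (u, v) \<in> parcs G)\<^sup>*\<^sup>* x y"
proof -
  have "x \<rightarrow>\<^sup>*\<^bsub>with_proj (mk_symmetric (with_proj G))\<^esub> y"
    using assms by (auto simp: connected_def strongly_connected_def)
  then have "(x, y) \<in> rtrancl_on (pverts G) (parcs (mk_symmetric (with_proj G)))"
    by (simp add: reachable_def)
  then show ?thesis
  proof induction
    case (step b c)
    have "(b, c) \<in> parcs G"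
      using step parcs_sym[OF G] by (auto simp: parcs_mk_symmetric)
    show ?case using converse_rtranclp_into_rtranclp[of "\<lambda>u v. (u, v) \<in> parcs G", OF \<open>(b, c) \<in> parcs G\<close>] step by blast
  qed simp
qed

lemma out_degree_conv: "out_degree (with_proj G) x = card {y. (x, y) \<in> parcs G}"
proof -
  have "out_arcs (with_proj G) x = Pair x ` {y. (x, y) \<in> parcs G}" by (auto simp: out_arcs_def)
  then show ?thesis unfolding out_degree_def by (simp add: card_image inj_on_def)
qed

text \<open>
  The eigenvalues of a complete graph on \<open>n\<close> vertices are among \<open>- 1\<close> and \<open>n - 1\<close>, so the
  bound \<open>lambda_min G < - 2\<close> excludes complete graphs.
\<close>

lemma lambda_min_complete:
  assumes fin: "finite (pverts G)" and ne: "pverts G \<noteq> {}"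
    and complete: "\<And>x y. x \<in> pverts G \<Longrightarrow> y \<in> pverts G \<Longrightarrow> (x, y) \<in> parcs G \<longleftrightarrow> x \<noteq> y"
  shows "- 1 \<le> lambda_min G"
proof -
  define n where "n = card (pverts G)"
  have n: "1 \<le> n" using fin ne by (simp add: n_def Suc_le_eq card_gt_0_iff)
  have len: "length xs = n" if "distinct xs" "set xs = pverts G" for xs
    using that distinct_card unfolding n_def by metis
  have A: "adjacency_mat G xs = mat n n (\<lambda>(i, j). if i = j then 0 else 1)"
    if xs: "distinct xs" "set xs = pverts G" for xs
  proof -
    have "(xs ! i, xs ! j) \<in> parcs G \<longleftrightarrow> i \<noteq> j" if "i < n" "j < n" for i j
      using complete[of "xs ! i" "xs ! j"] xs that len[OF xs] nth_mem nth_eq_iff_index_eq by metis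
    then show ?thesis unfolding adjacency_mat_def len[OF xs] by (intro eq_matI) auto
  qed
  have Av: "(mat n n (\<lambda>(i, j). if i = j then 0 else 1) *\<^sub>v v) $ i = (\<Sum>j<n. v $ j) - v $ i"
    if "i < n" "v \<in> carrier_vec n" for i and v :: "real vec"
  proof -
    have "(mat n n (\<lambda>(i, j). if i = j then 0 else 1) *\<^sub>v v) $ i
        = (\<Sum>j = 0..<n. (if i = j then 0 else 1) * v $ j)"
      using that by (simp add: scalar_prod_def)
    also have "\<dots> = (\<Sum>j<n. v $ j - (if i = j then v $ j else 0))"
      by (intro sum.cong) auto
    also have "\<dots> = (\<Sum>j<n. v $ j) - v $ i" using that by (simp add: sum_subtractf)
    finally show ?thesis .
  qed
  have sub: "graph_eigenvalues G \<subseteq> {- 1, real n - 1}"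
  proof
    fix \<theta> assume "\<theta> \<in> graph_eigenvalues G"
    then obtain xs where xs: "distinct xs" "set xs = pverts G" "eigenvalue (adjacency_mat G xs) \<theta>"
      by (auto simp: graph_eigenvalues_def)
    then obtain v where v: "v \<in> carrier_vec n" "v \<noteq> 0\<^sub>v n"
      "mat n n (\<lambda>(i, j). if i = j then 0 else 1) *\<^sub>v v = \<theta> \<cdot>\<^sub>v v"
      unfolding eigenvalue_def eigenvector_def by (auto simp: A[OF xs(1,2)])
    define s where "s = (\<Sum>j<n. v $ j)"
    have eq: "(\<theta> + 1) * v $ i = s" if "i < n" for i
    proof -
      have "s - v $ i = (\<theta> \<cdot>\<^sub>v v) $ i" using Av[OF that v(1)] v(3) by (simp add: s_def)
      then show ?thesis using v(1) that by (simp add: algebra_simps)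
    qed
    show "\<theta> \<in> {- 1, real n - 1}"
    proof (cases "\<theta> = - 1")
      case False
      have "(\<theta> + 1) * s = (\<Sum>i<n. (\<theta> + 1) * v $ i)" by (simp add: s_def sum_distrib_left)
      also have "\<dots> = real n * s" using eq by simp
      finally have "(\<theta> + 1 - real n) * s = 0" by (simp add: algebra_simps)
      moreover have "s \<noteq> 0"
      proof
        assume "s = 0"
        then have "v = 0\<^sub>v n" using eq False v(1) by (intro eq_vecI) auto
        then show False using v(2) by simp
      qed
      ultimately show ?thesis by simp
    qed simp
  qed
  have "real n - 1 \<in> graph_eigenvalues G"
  proof -
    obtain xs where xs: "distinct xs" "set xs = pverts G" using finite_distinct_list[OF fin] by blast
    define v :: "real vec" where "v = vec n (\<lambda>_. 1)"
    have v: "v \<in> carrier_vec n" by (simp add: v_def)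
    have "mat n n (\<lambda>(i, j). if i = j then 0 else 1) *\<^sub>v v = (real n - 1) \<cdot>\<^sub>v v"
    proof (rule eq_vecI)
      fix i assume "i < dim_vec ((real n - 1) \<cdot>\<^sub>v v)"
      then have i: "i < n" by (simp add: v_def)
      show "(mat n n (\<lambda>(i, j). if i = j then 0 else 1) *\<^sub>v v) $ i = ((real n - 1) \<cdot>\<^sub>v v) $ i"
        using Av[OF i v] i by (simp add: v_def)
    qed (simp add: v_def)
    moreover have "v \<noteq> 0\<^sub>v n"
    proof
      assume "v = 0\<^sub>v n"
      then have "v $ 0 = 0" using n by simp
      then show False using n by (simp add: v_def)
    qed
    ultimately have "eigenvalue (adjacency_mat G xs) (real n - 1)"
      unfolding eigenvalue_def eigenvector_def A[OF xs] using v by auto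
    then show ?thesis using xs by (auto simp: graph_eigenvalues_def)
  qed
  moreover have "finite (graph_eigenvalues G)" using sub by (rule finite_subset) simp
  ultimately have "lambda_min G \<in> {- 1, real n - 1}"
    unfolding lambda_min_def using Min_in[of "graph_eigenvalues G"] sub by blast
  then show ?thesis using n by auto
qed

section \<open>Integral vectors of norm three\<close>

text \<open>
  The index \<open>i\<close> is shifted by one so that \<open>0\<close>, which is its own opposite, is not a point.
\<close>

definition signed_support :: "int vec \<Rightarrow> int set" where
  "signed_support v = (\<lambda>i. v $ i * (int i + 1)) ` {i. i < dim_vec v \<and> v $ i \<noteq> 0}"

definition unit_entries :: "int vec \<Rightarrow> bool" where
  "unit_entries v \<longleftrightarrow> (\<forall>i<dim_vec v. v $ i \<in> {- 1, 0, 1})"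

lemma norm_3_unit_entries:
  assumes "v \<in> carrier_vec m" "v \<bullet> v = (3 :: int)"
  shows "unit_entries v"
  unfolding unit_entries_def
proof (intro allI impI)
  fix i assume i: "i < dim_vec v"
  have "v $ i * v $ i \<le> (\<Sum>j = 0..<dim_vec v. v $ j * v $ j)"
    by (rule member_le_sum) (use i in auto)
  then have le: "v $ i * v $ i \<le> 3" using assms(2) by (simp add: scalar_prod_def)
  have "\<bar>v $ i\<bar> < 2"
  proof (rule ccontr)
    assume "\<not> \<bar>v $ i\<bar> < 2"
    then have "2 * 2 \<le> \<bar>v $ i\<bar> * \<bar>v $ i\<bar>" by (intro mult_mono) auto
    then show False using le by (simp add: abs_mult_self_eq)
  qed
  then show "v $ i \<in> {- 1, 0, 1}" by auto
qed

lemma signed_point_eq: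
  assumes "v $ i * (int i + 1) = w $ j * (int j + 1)" "v $ i \<in> {- 1, 1}" "w $ j \<in> {- 1, 1 :: int}"
  shows "i = j \<and> v $ i = w $ j"
  using assms by auto

lemma signed_support_inj: "unit_entries v \<Longrightarrow>
  inj_on (\<lambda>i. v $ i * (int i + 1)) {i. i < dim_vec v \<and> v $ i \<noteq> 0}"
  by (auto simp: inj_on_def unit_entries_def dest!: signed_point_eq)

lemma common_points:
  assumes v: "unit_entries v" "v \<in> carrier_vec m" and w: "unit_entries w" "w \<in> carrier_vec m"
  shows "card (signed_support v \<inter> signed_support w) = card {i. i < m \<and> v $ i \<noteq> 0 \<and> v $ i = w $ i}"
proof -
  have eq: "signed_support v \<inter> signed_support w
      = (\<lambda>i. v $ i * (int i + 1)) ` {i. i < m \<and> v $ i \<noteq> 0 \<and> v $ i = w $ i}" (is "?l = ?r")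
  proof
    show "?l \<subseteq> ?r"
    proof
      fix a assume "a \<in> ?l"
      then have a: "a \<in> signed_support v" "a \<in> signed_support w" by simp_all
      obtain i where i: "a = v $ i * (int i + 1)" "i < dim_vec v" "v $ i \<noteq> 0"
        using a(1) by (auto simp: signed_support_def)
      obtain j where j: "a = w $ j * (int j + 1)" "j < dim_vec w" "w $ j \<noteq> 0"
        using a(2) by (auto simp: signed_support_def)
      note ij = i j
      have "v $ i \<in> {- 1, 1}" "w $ j \<in> {- 1, 1}"
        using ij v w unfolding unit_entries_def by auto
      then have "i = j \<and> v $ i = w $ j" using ij signed_point_eq[of v i w j] by simp
      then have "i < m" "v $ i = w $ i" using i(2) v(2) by auto
      then show "a \<in> ?r" using i(1,3) by simp
    qed
    show "?r \<subseteq> ?l"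
    proof
      fix a assume "a \<in> ?r"
      then obtain i where i: "a = v $ i * (int i + 1)" "i < m" "v $ i \<noteq> 0" "v $ i = w $ i" by blast
      then have w': "a = w $ i * (int i + 1)" "w $ i \<noteq> 0" by simp_all
      have "a \<in> signed_support v"
        unfolding signed_support_def using i v(2) by (intro image_eqI[where x = i]) auto
      moreover have "a \<in> signed_support w"
        unfolding signed_support_def using i w' w(2) by (intro image_eqI[where x = i]) auto
      ultimately show "a \<in> ?l" by simp
    qed
  qed
  show ?thesis unfolding eq
    by (rule card_image) (rule inj_on_subset[OF signed_support_inj[OF v(1)]], use v(2) in auto)
qed

lemma signed_support_uminus:
  "v \<in> carrier_vec m \<Longrightarrow> uminus ` signed_support v = signed_support (- v)"
  unfolding signed_support_def image_image by (rule image_cong) auto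

lemma unit_entries_uminus: "unit_entries v \<Longrightarrow> unit_entries (- v)"
  by (auto simp: unit_entries_def)

lemma scalar_prod_signed_support:
  assumes v: "unit_entries v" "v \<in> carrier_vec m" and w: "unit_entries w" "w \<in> carrier_vec m"
  shows "v \<bullet> w = int (card (signed_support v \<inter> signed_support w))
    - int (card (signed_support v \<inter> uminus ` signed_support w))"
proof -
  have w': "unit_entries (- w)" "- w \<in> carrier_vec m" using w unit_entries_uminus by auto
  have "v \<bullet> w = (\<Sum>i<m. v $ i * w $ i)" using w by (simp add: scalar_prod_def lessThan_atLeast0)
  also have "\<dots> = (\<Sum>i<m. (if v $ i \<noteq> 0 \<and> v $ i = w $ i then 1 else 0)
      - (if v $ i \<noteq> 0 \<and> v $ i = - w $ i then 1 else 0))"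
  proof (rule sum.cong[OF refl])
    fix i assume "i \<in> {..<m}"
    then have "v $ i \<in> {- 1, 0, 1}" "w $ i \<in> {- 1, 0, 1}" using v w by (auto simp: unit_entries_def)
    then show "v $ i * w $ i = (if v $ i \<noteq> 0 \<and> v $ i = w $ i then 1 else 0)
      - (if v $ i \<noteq> 0 \<and> v $ i = - w $ i then 1 else 0)" by auto
  qed
  also have "\<dots> = int (card {i. i < m \<and> v $ i \<noteq> 0 \<and> v $ i = w $ i})
      - int (card {i. i < m \<and> v $ i \<noteq> 0 \<and> v $ i = - w $ i})"
    by (simp add: sum_subtractf sum.If_cases Int_def lessThan_def)
  also have "{i. i < m \<and> v $ i \<noteq> 0 \<and> v $ i = - w $ i} = {i. i < m \<and> v $ i \<noteq> 0 \<and> v $ i = (- w) $ i}"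
    using w by auto
  finally show ?thesis
    using common_points[OF v w] common_points[OF v w'] signed_support_uminus[OF w(2)] by simp
qed

lemma card_signed_support:
  assumes v: "v \<in> carrier_vec m" "v \<bullet> v = (3 :: int)"
  shows "card (signed_support v) = 3" and "a \<in> signed_support v \<Longrightarrow> - a \<notin> signed_support v"
proof -
  have u: "unit_entries v" using norm_3_unit_entries[OF v] .
  have u': "unit_entries (- v)" using unit_entries_uminus[OF u] .
  have "card (signed_support v \<inter> uminus ` signed_support v) = card {i. i < m \<and> v $ i \<noteq> 0 \<and> v $ i = (- v) $ i}"
    using common_points[OF u v(1) u'] signed_support_uminus[OF v(1)] v(1) by simp
  also have "{i. i < m \<and> v $ i \<noteq> 0 \<and> v $ i = (- v) $ i} = {}" using v(1) by auto
  finally have c: "card (signed_support v \<inter> uminus ` signed_support v) = 0" by simp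
  then show "card (signed_support v) = 3"
    using scalar_prod_signed_support[OF u v(1) u v(1)] v(2) by simp
  have "finite (signed_support v)" by (simp add: signed_support_def)
  then have "signed_support v \<inter> uminus ` signed_support v = {}" using c by auto
  then show "a \<in> signed_support v \<Longrightarrow> - a \<notin> signed_support v" using uminus_image_iff by blast
qed

section \<open>Sesqui-regular graphs\<close>

theorem theorem1p8:
  fixes G :: "'a pair_pre_digraph" and n k c :: nat
  assumes "pair_graph G"
    and "connected (with_proj G)"
    and "sesqui_regular G n k c"
    and "c + 2 \<le> k" and "9 \<le> c"
    and "- 3 \<le> lambda_min G" and "lambda_min G < - 2"
    and "integrable_graph 1 G"
  shows "c = 9 \<and> is_sts_block_graph G"
proof -
  interpret pair_graph G by (rule assms(1))
  let ?V = "pverts G" and ?E = "parcs G"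
  have irrefl: "(x, x) \<notin> ?E" for x using pair_no_loops by fastforce
  have arcV: "x \<in> ?V" "y \<in> ?V" if "(x, y) \<in> ?E" for x y using that in_arcsD1 in_arcsD2 by blast+
  have ceil: "\<lceil>- lambda_min G\<rceil> = 3" using assms(6,7) by (simp add: ceiling_eq_iff)
  obtain m f where f: "\<And>x. x \<in> ?V \<Longrightarrow> f x \<in> carrier_vec m"
    and ip: "\<And>x y. x \<in> ?V \<Longrightarrow> y \<in> ?V \<Longrightarrow>
      f x \<bullet> f y = (if x = y then 3 else if (x, y) \<in> ?E then 1 else 0 :: int)"
  proof -
    obtain m f where "\<forall>x\<in>?V. f x \<in> carrier_vec m" and
      "\<forall>x\<in>?V. \<forall>y\<in>?V. f x \<bullet> f y = (if x = y then int 1 * 3 else if (x, y) \<in> ?E then int 1 else 0)"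
      using assms(8) unfolding integrable_graph_def ceil by blast
    then show thesis by (intro that[of f m]) auto
  qed
  define S where "S x = signed_support (f x)" for x
  have n3: "f x \<bullet> f x = 3" if "x \<in> ?V" for x using ip[OF that that] by simp
  have S3: "card (S x) = 3" and Sopp: "a \<in> S x \<Longrightarrow> - a \<notin> S x" if "x \<in> ?V" for x a
    using card_signed_support[OF f[OF that] n3[OF that]] by (auto simp: S_def)
  have Sip: "int (card (S x \<inter> S y)) - int (card (S x \<inter> uminus ` S y)) = (if (x, y) \<in> ?E then 1 else 0)"
    if "x \<in> ?V" "y \<in> ?V" "x \<noteq> y" for x y
    using scalar_prod_signed_support[OF norm_3_unit_entries[OF f n3] f norm_3_unit_entries[OF f n3] f,
        OF that(1,1,1) that(2,2,2)] ip[OF that(1,2)] that(3)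
    by (simp add: S_def)
  have inj: "inj_on S ?V"
  proof (rule inj_onI, rule ccontr)
    fix x y assume xy: "x \<in> ?V" "y \<in> ?V" "S x = S y" "x \<noteq> y"
    have "S x \<inter> uminus ` S y = {}" using xy Sopp uminus_image_iff by blast
    then show False using Sip[OF xy(1,2,4)] xy S3 by (simp split: if_splits)
  qed
  define L where "L = S ` ?V"
  interpret T: signed_triples L
  proof
    show "finite L" by (simp add: L_def)
    show "card l = 3" if "l \<in> L" for l using that S3 by (auto simp: L_def)
    show "- a \<notin> l" if "l \<in> L" "a \<in> l" for l a using that Sopp by (auto simp: L_def)
    fix l m assume lm: "l \<in> L" "m \<in> L" "l \<noteq> m"
    then obtain x y where xy: "l = S x" "m = S y" "x \<in> ?V" "y \<in> ?V" "x \<noteq> y" by (auto simp: L_def)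
    show "card (l \<inter> m) = card (l \<inter> uminus ` m) \<or> card (l \<inter> m) = Suc (card (l \<inter> uminus ` m))"
      using Sip[OF xy(3-5)] xy(1,2) by (auto split: if_splits)
  qed
  have adj: "T.adj (S x) (S y) \<longleftrightarrow> (x, y) \<in> ?E" if "x \<in> ?V" "y \<in> ?V" for x y
  proof (cases "x = y")
    case False
    then have "S x \<noteq> S y" using inj that by (auto dest: inj_onD)
    moreover have "S x \<in> L" "S y \<in> L" using that by (simp_all add: L_def)
    ultimately show ?thesis using Sip[OF that False] by (auto simp: T.adj_def split: if_splits)
  qed (use irrefl in \<open>auto simp: T.adj_def\<close>)
  have nbrs: "T.nbrs (S x) = S ` {y. (x, y) \<in> ?E}" if "x \<in> ?V" for x
  proof
    show "T.nbrs (S x) \<subseteq> S ` {y. (x, y) \<in> ?E}"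
    proof
      fix l assume "l \<in> T.nbrs (S x)"
      then have l: "T.adj (S x) l" by (simp add: T.nbrs_def)
      then obtain y where "y \<in> ?V" "l = S y" using T.adj_lines(2)[OF l] by (auto simp: L_def)
      then show "l \<in> S ` {y. (x, y) \<in> ?E}" using adj[OF that] l by blast
    qed
    show "S ` {y. (x, y) \<in> ?E} \<subseteq> T.nbrs (S x)" using adj[OF that] arcV by (auto simp: T.nbrs_def)
  qed
  have sub: "{y. (x, y) \<in> ?E} \<subseteq> ?V" for x using arcV by blast
  have not_complete: "\<exists>x\<in>?V. \<exists>y\<in>?V. x \<noteq> y \<and> (x, y) \<notin> ?E"
  proof (rule ccontr)
    assume "\<not> ?thesis"
    then have "(x, y) \<in> ?E \<longleftrightarrow> x \<noteq> y" if "x \<in> ?V" "y \<in> ?V" for x y using that irrefl by blast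
    moreover have "?V \<noteq> {}" using assms(2) by (auto simp: connected_def strongly_connected_def)
    ultimately have "- 1 \<le> lambda_min G" by (intro lambda_min_complete) auto
    then show False using assms(7) by simp
  qed
  interpret T: sesqui_triples L k c
  proof
    fix l m assume "l \<in> L" "m \<in> L"
    then obtain x y where xy: "l = S x" "m = S y" "x \<in> ?V" "y \<in> ?V" by (auto simp: L_def)
    have "(\<lambda>u v. (u, v) \<in> ?E)\<^sup>*\<^sup>* x y" by (rule connected_imp_rtranclp[OF assms(1,2) xy(3,4)])
    then have "T.adj\<^sup>*\<^sup>* (S x) (S y)"
    proof induction
      case (step y z)
      then show ?case using adj[of y z] arcV[of y z] by (simp add: rtranclp.rtrancl_into_rtrancl)
    qed simp
    then show "T.adj\<^sup>*\<^sup>* l m" using xy by simp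
  next
    fix l assume "l \<in> L"
    then obtain x where x: "l = S x" "x \<in> ?V" by (auto simp: L_def)
    have "card (T.nbrs l) = card {y. (x, y) \<in> ?E}"
      unfolding x(1) nbrs[OF x(2)] by (rule card_image) (rule inj_on_subset[OF inj sub])
    also have "\<dots> = k" using assms(3) x(2) by (simp add: sesqui_regular_def flip: out_degree_conv)
    finally show "card (T.nbrs l) = k" .
  next
    fix l r m assume a: "T.adj l r" "T.adj r m" "l \<noteq> m" "\<not> T.adj l m"
    then obtain x z y where x: "l = S x" "x \<in> ?V" "r = S z" "z \<in> ?V" "m = S y" "y \<in> ?V"
      using T.adj_lines[OF a(1)] T.adj_lines(2)[OF a(2)] unfolding L_def by (elim imageE) blast
    have e: "(x, z) \<in> ?E" "(z, y) \<in> ?E" "(x, y) \<notin> ?E" "x \<noteq> y" using a x adj by auto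
    have "T.nbrs l \<inter> T.nbrs m = S ` ({v. (x, v) \<in> ?E} \<inter> {v. (y, v) \<in> ?E})"
      unfolding x(1,5) nbrs[OF x(2)] nbrs[OF x(6)] using inj sub by (simp add: inj_on_image_Int)
    also have "card \<dots> = card ({v. (x, v) \<in> ?E} \<inter> {v. (y, v) \<in> ?E})"
      by (rule card_image) (rule inj_on_subset[OF inj], use sub in blast)
    also have "{v. (x, v) \<in> ?E} \<inter> {v. (y, v) \<in> ?E} = {v \<in> ?V. (x, v) \<in> ?E \<and> (y, v) \<in> ?E}"
      using arcV by blast
    also have "card \<dots> = c"
      using assms(3) x(2,6) distance_eq_2[OF assms(1) e(4,3,1,2)] by (simp add: sesqui_regular_def)
    finally show "card (T.nbrs l \<inter> T.nbrs m) = c" .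
  next
    obtain x y where xy: "x \<in> ?V" "y \<in> ?V" "x \<noteq> y" "(x, y) \<notin> ?E" using not_complete by blast
    moreover have "S x \<in> L" "S y \<in> L" using xy by (simp_all add: L_def)
    moreover have "S x \<noteq> S y" using inj xy by (auto dest: inj_onD)
    ultimately show "\<exists>l\<in>L. \<exists>m\<in>L. l \<noteq> m \<and> \<not> T.adj l m" using adj by blast
  qed (use assms in auto)
  \<comment> \<open>The points of the Steiner triple system are to be natural numbers.\<close>
  define g where "g x = int_encode ` S x" for x
  define B where "B = g ` ?V"
  have B: "B = (`) int_encode ` L" by (auto simp: B_def g_def L_def)
  have enc: "inj int_encode" by (rule inj_int_encode)
  have ginj: "inj_on g ?V"
  proof (rule inj_onI)
    fix x y assume xy: "x \<in> ?V" "y \<in> ?V" "g x = g y"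
    then have "S x = S y" using enc by (simp add: g_def inj_image_eq_iff)
    then show "x = y" using inj xy by (auto dest: inj_onD)
  qed
  have gadj: "card (g x \<inter> g y) = 1 \<longleftrightarrow> (x, y) \<in> ?E" if "x \<in> ?V" "y \<in> ?V" for x y
  proof -
    have "card (g x \<inter> g y) = card (int_encode ` (S x \<inter> S y))"
      unfolding g_def using image_Int[OF enc] by metis
    also have "\<dots> = card (S x \<inter> S y)" by (rule card_image) (rule inj_on_subset[OF enc], simp)
    finally show ?thesis using T.adj_iff_card[of "S x" "S y"] adj[OF that] that by (simp add: L_def)
  qed
  let ?h = "\<lparr>iso_verts = g, iso_arcs = map_prod g g, iso_head = snd, iso_tail = fst\<rparr>"
  have "inj_on (map_prod g g) ?E"
    by (rule inj_on_subset[OF map_prod_inj_on[OF ginj ginj]]) (use arcV in auto)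
  then have "digraph_isomorphism ?h"
    using ginj wf_digraph_axioms by (simp add: digraph_isomorphism_def)
  moreover have "with_proj (block_graph B) = app_iso ?h (with_proj G)"
  proof -
    have "{(b, b'). b \<in> B \<and> b' \<in> B \<and> card (b \<inter> b') = 1} = map_prod g g ` ?E"
    proof
      show "{(b, b'). b \<in> B \<and> b' \<in> B \<and> card (b \<inter> b') = 1} \<subseteq> map_prod g g ` ?E"
        using gadj by (auto simp: B_def)
      show "map_prod g g ` ?E \<subseteq> {(b, b'). b \<in> B \<and> b' \<in> B \<and> card (b \<inter> b') = 1}"
        using gadj arcV by (auto simp: B_def)
    qed
    then show ?thesis by (simp add: app_iso_def with_proj_def block_graph_def B_def)
  qed
  ultimately have "digraph_iso (with_proj G) (with_proj (block_graph B))"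
    unfolding digraph_iso_def by blast
  moreover have "steiner_triple_system (card (int_encode ` \<Union>L)) (int_encode ` \<Union>L) B"
    unfolding B by (rule T.steiner_triple_system_lines[OF enc])
  ultimately have "is_sts_block_graph G" unfolding is_sts_block_graph_def by blast
  then show ?thesis using T.c_eq_9 by simp
qed

end
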